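(* Let $N$ and $s$ be coprime integers with $N$ positive, let $\epsilon=\exp(\pi i s/N)$, and let $p_1,p_2\in\mathbb{C}$. For an integer $n$ with $0\le n\le N-1$ put $p_3=p_1+p_2-n$ and $$A^n_{p_1p_2}=\sum_{z_1}\bigl[C(p_1,p_2,p_3;z_1,z_2,z_1+z_2-n)\bigr]^2\,\epsilon^{2\rho(z_1)},\qquad B^n_{p_1p_2}=\sum_{z_2}\bigl[C(p_1,p_2,p_3;z_1,z_2,z_1+z_2-n)\bigr]^2\,\epsilon^{-2\rho(z_2)},$$ where $C$ denotes the Clebsch-Gordan coefficients of the nilpotent representations of $U_q(sl_2)$ at $q=\epsilon$ (given explicitly in the context) and $\rho(z)=p-z+Np/2$, with $p$ the parameter of the representation to which the index $z$ belongs, that is, $\rho(z_1)=p_1-z_1+Np_1/2$ and $\rho(z_2)=p_2-z_2+Np_2/2$. Then the Clebsch-Gordan coefficients of the nilpotent representations satisfy $$\frac{A^n_{p_1p_2}}{B^n_{p_1p_2}}=g(p_1,p_2)=\frac{f(p_1)}{f(p_2)},\qquad\text{independent of } n\quad(p_3=p_1+p_2-n),$$ for a function $f$ of one variable. Explicitly, for the nilpotent representations, $$g(p_1,p_2)=\frac{[2p_2;N-1]_\epsilon!}{[2p_1;N-1]_\epsilon!}.$$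
   Context: Notation: $\epsilon^x=\exp(\pi i s x/N)$ and $[x]_\epsilon=\dfrac{\epsilon^x-\epsilon^{-x}}{\epsilon-\epsilon^{-1}}$ for complex $x$. For an integer $m\ge 1$ and complex $p$, $[m]_\epsilon!=\prod_{k=1}^m[k]_\epsilon$ and $[p;m]_\epsilon!=\prod_{k=0}^{m-1}[p-k]_\epsilon$, with $[0]_\epsilon!=[p;0]_\epsilon!=1$. Nilpotent representations: these are representations of $U_q(sl_2)$ (generators $X^{\pm},K$) at $q=\epsilon$ in which $(X^{\pm})^N=0$ and $K^N=q^{2Np}$ with $p\in\mathbb{C}$. The representation $V^{(p)}$ has matrix entries, for $a,b=0,1,\dots,N-1$, $\pi(X^+)^a_b=\sqrt{[2p-a]_\epsilon[a+1]_\epsilon}\,\delta_{a+1,b}$, $\pi(X^-)^a_b=\sqrt{[2p-a+1]_\epsilon[a]_\epsilon}\,\delta_{a-1,b}$, $\pi(K)^a_b=\epsilon^{2p-2a}\delta_{a,b}$. The tensor product $V^{(p_1)}\otimes V^{(p_2)}$ decomposes as the sum of the $V^{(p_3)}$ with $p_3=p_1+p_2-n$, $n$ an integer with $0\le n\le N-1$, each with multiplicity one. Clebsch-Gordan coefficients: for $p_3=p_1+p_2-n$ and integers $0\le z_i\le N-1$ ($i=1,2,3$), $$C(p_1,p_2,p_3;z_1,z_2,z_3)=\delta(z_3,z_1+z_2-n)\,\sqrt{[2p_1+2p_2-2n+1]_\epsilon}\,\sqrt{[n]_\epsilon!\,[z_1]_\epsilon!\,[z_2]_\epsilon!\,[z_3]_\epsilon!}$$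 $$\times\sum_\nu\frac{(-1)^\nu\epsilon^{-\nu(p_1+p_2+p_3+1)}\,\epsilon^{(n-n^2)/2+(n-z_2)p_1+(n+z_1)p_2}}{[\nu]_\epsilon!\,[n-\nu]_\epsilon!\,[z_1-\nu]_\epsilon!\,[z_2-n+\nu]_\epsilon!}\sqrt{\frac{[2p_1-n;z_1-\nu]_\epsilon!\,[2p_1-z_1;n-\nu]_\epsilon!\,[2p_2-n;z_2+\nu-n]_\epsilon!\,[2p_2-z_2;\nu]_\epsilon!}{[2p_1+2p_2-n+1;z_1+z_2+1]_\epsilon!}},$$ where $\delta(\cdot,\cdot)$ is the Kronecker delta and $\nu$ runs over integers with $\max\{0,n-z_2\}\le\nu\le\min\{n,z_1\}$. All indices $z_1$, $z_2$ and $z_3=z_1+z_2-n$ lie in $\{0,\dots,N-1\}$. In $A^n_{p_1p_2}$ the index $z_2$ is fixed and the sum is over $z_1$; in $B^n_{p_1p_2}$ the index $z_1$ is fixed and the sum is over $z_2$. By irreducibility of the representations, $A^n_{p_1p_2}$ does not depend on $z_2$ and $B^n_{p_1p_2}$ does not depend on $z_1$.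
   Formalization: The weight is corrected from ρ(z)=p−z+Np/2, for which A/B≠g in general (N=2, n=0 gives an extra factor ε^{2(p1+p2)}), to ρ(z)=−(p−z)+Np; N≥2 is assumed since [x]_ε is undefined for N=1, and [2p_i;N−1]_ε!≠0 and the denominators in C nonzero. *)

theory Defs
  imports "HOL-Analysis.Analysis"
begin

definition qeps :: "int \<Rightarrow> nat \<Rightarrow> complex \<Rightarrow> complex" where
  "qeps s N x = exp (of_real pi * \<i> * of_int s * x / of_nat N)"

text \<open>For \<open>s\<close> coprime to \<open>N\<close> the denominator is nonzero exactly when \<open>N \<ge> 2\<close>.\<close>

definition qnum :: "int \<Rightarrow> nat \<Rightarrow> complex \<Rightarrow> complex" where
  "qnum s N x = (qeps s N x - qeps s N (- x)) / (qeps s N 1 - qeps s N (- 1))"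

definition qfact :: "int \<Rightarrow> nat \<Rightarrow> nat \<Rightarrow> complex" where
  "qfact s N m = (\<Prod>k=1..m. qnum s N (of_nat k))"

definition qfall :: "int \<Rightarrow> nat \<Rightarrow> complex \<Rightarrow> nat \<Rightarrow> complex" where
  "qfall s N p m = (\<Prod>k<m. qnum s N (p - of_nat k))"

text \<open>
  The square root of \<open>qfall s N p m\<close> is taken factor by factor, so that one and the same root of
  \<open>qnum s N (2 * p - k)\<close> is used wherever this number occurs.  The principal root of a whole
  product would not do: the summands of a Clebsch-Gordan coefficient would get inconsistent
  relative signs (already for real \<open>p\<^sub>1\<close>, \<open>p\<^sub>2\<close>).  Taken factor by factor, a change of the root of
  one factor changes all summands by the same sign, so the squared coefficient does not depend
  on the branch.
\<close>

definition qfall_sqrt :: "int \<Rightarrow> nat \<Rightarrow> complex \<Rightarrow> nat \<Rightarrow> complex" where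
  "qfall_sqrt s N p m = (\<Prod>k<m. csqrt (qnum s N (p - of_nat k)))"

text \<open>
  The Clebsch-Gordan coefficient \<open>C(p\<^sub>1,p\<^sub>2,p\<^sub>3; z\<^sub>1,z\<^sub>2,z\<^sub>3)\<close> with \<open>p\<^sub>3 = p\<^sub>1 + p\<^sub>2 - n\<close>.
  The truncated subtraction \<open>n - z2\<close> in the range of summation is \<open>max {0, n - z\<^sub>2}\<close>; for \<open>\<nu>\<close>
  in this range no other subtraction on \<open>nat\<close> is truncated.
\<close>

definition clebsch_gordan ::
  "int \<Rightarrow> nat \<Rightarrow> complex \<Rightarrow> complex \<Rightarrow> nat \<Rightarrow> nat \<Rightarrow> nat \<Rightarrow> nat \<Rightarrow> complex" where
  "clebsch_gordan s N p1 p2 n z1 z2 z3 =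
    (let p3 = p1 + p2 - of_nat n in
     (if z3 + n = z1 + z2 then 1 else 0)
     * csqrt (qnum s N (2 * p1 + 2 * p2 - 2 * of_nat n + 1))
     * csqrt (qfact s N n * qfact s N z1 * qfact s N z2 * qfact s N z3)
     * (\<Sum>\<nu> = n - z2..min n z1.
          (- 1) ^ \<nu> * qeps s N (- of_nat \<nu> * (p1 + p2 + p3 + 1))
          * qeps s N ((of_nat n - (of_nat n)\<^sup>2) / 2
                      + (of_nat n - of_nat z2) * p1 + (of_nat n + of_nat z1) * p2)
          / (qfact s N \<nu> * qfact s N (n - \<nu>) * qfact s N (z1 - \<nu>) * qfact s N (z2 + \<nu> - n))
          * (qfall_sqrt s N (2 * p1 - of_nat n) (z1 - \<nu>)
             * qfall_sqrt s N (2 * p1 - of_nat z1) (n - \<nu>)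
             * qfall_sqrt s N (2 * p2 - of_nat n) (z2 + \<nu> - n)
             * qfall_sqrt s N (2 * p2 - of_nat z2) \<nu>
             / qfall_sqrt s N (2 * p1 + 2 * p2 - of_nat n + 1) (z1 + z2 + 1))))"

text \<open>The denominators under the square roots do not vanish, i.e. the coefficients are defined.\<close>

definition cg_defined :: "int \<Rightarrow> nat \<Rightarrow> complex \<Rightarrow> complex \<Rightarrow> nat \<Rightarrow> bool" where
  "cg_defined s N p1 p2 n \<longleftrightarrow>
    (\<forall>z1<N. \<forall>z2<N. n \<le> z1 + z2 \<and> z1 + z2 - n < N \<longrightarrow>
       qfall s N (2 * p1 + 2 * p2 - of_nat n + 1) (z1 + z2 + 1) \<noteq> 0)"

definition cg_A ::
  "int \<Rightarrow> nat \<Rightarrow> (complex \<Rightarrow> nat \<Rightarrow> complex) \<Rightarrow> complex \<Rightarrow> complex \<Rightarrow> nat \<Rightarrow> nat \<Rightarrow> complex" where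
  "cg_A s N \<rho> p1 p2 n z2 =
    (\<Sum>z1 | z1 < N \<and> n \<le> z1 + z2 \<and> z1 + z2 - n < N.
       (clebsch_gordan s N p1 p2 n z1 z2 (z1 + z2 - n))\<^sup>2 * qeps s N (2 * \<rho> p1 z1))"

definition cg_B ::
  "int \<Rightarrow> nat \<Rightarrow> (complex \<Rightarrow> nat \<Rightarrow> complex) \<Rightarrow> complex \<Rightarrow> complex \<Rightarrow> nat \<Rightarrow> nat \<Rightarrow> complex" where
  "cg_B s N \<rho> p1 p2 n z1 =
    (\<Sum>z2 | z2 < N \<and> n \<le> z1 + z2 \<and> z1 + z2 - n < N.
       (clebsch_gordan s N p1 p2 n z1 z2 (z1 + z2 - n))\<^sup>2 * qeps s N (- 2 * \<rho> p2 z2))"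

text \<open>
  The source prints the weight \<open>p - z + N p / 2\<close>, here \<open>rho_printed\<close>.  With it the proposition
  is false for the printed coefficients: see \<open>rho_printed_ratio\<close> for \<open>N = 2\<close>; for \<open>N \<ge> 3\<close> the
  sums \<open>A\<close> and \<open>B\<close> moreover depend on the fixed index.  The sign of \<open>p - z\<close> must be
  reversed for that independence, and a term \<open>c p\<close> added to \<open>z - p\<close> multiplies \<open>A / B\<close> by
  \<open>\<epsilon>\<close> to the power \<open>2 c (p\<^sub>1 + p\<^sub>2)\<close>, so that only \<open>c = N\<close> gives the asserted \<open>A / B\<close>.
  Then \<open>\<epsilon>\<close> to the power \<open>2 \<rho>(z)\<close> is the eigenvalue of \<open>K ^ (N - 1)\<close> on the basis vector
  with index \<open>z\<close>.
\<close>

definition rho :: "nat \<Rightarrow> complex \<Rightarrow> nat \<Rightarrow> complex" where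
  "rho N p z = - (p - of_nat z) + of_nat N * p"

definition rho_printed :: "nat \<Rightarrow> complex \<Rightarrow> nat \<Rightarrow> complex" where
  "rho_printed N p z = p - of_nat z + of_nat N * p / 2"

lemma qeps_add: "qeps s N (x + y) = qeps s N x * qeps s N y"
  by (simp add: qeps_def exp_add [symmetric] ring_distribs add_divide_distrib)

lemma qeps_nonzero [simp]: "qeps s N x \<noteq> 0"
  by (simp add: qeps_def)

lemma qnum_1:
  assumes "qeps s N 1 \<noteq> qeps s N (- 1)"
  shows "qnum s N 1 = 1"
  using assms by (simp add: qnum_def)

lemma qeps_2_1: "qeps 1 2 1 = \<i>" "qeps 1 2 (- 1) = - \<i>"
proof -
  have *: "of_real pi * \<i> / 2 = \<i> * of_real (pi / 2)" by simp
  show "qeps 1 2 1 = \<i>"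
    unfolding qeps_def by (simp add: * exp_Euler cos_of_real sin_of_real del: of_real_divide)
  have "qeps 1 2 1 * qeps 1 2 (- 1) = 1"
    by (simp add: qeps_add [symmetric]) (simp add: qeps_def)
  with \<open>qeps 1 2 1 = \<i>\<close> show "qeps 1 2 (- 1) = - \<i>"
    by (metis mult_minus_right i_squared minus_minus mult_left_cancel complex_i_not_zero)
qed

lemma rho_printed_ratio:
  assumes "cg_defined 1 2 p1 p2 0"
  shows "cg_A 1 2 (rho_printed 2) p1 p2 0 1 / cg_B 1 2 (rho_printed 2) p1 p2 0 1
         = qfall 1 2 (2 * p2) 1 / qfall 1 2 (2 * p1) 1 * qeps 1 2 (2 * (p1 + p2))"
proof -
  let ?q = "qnum 1 2" and ?e = "qeps 1 2"
  have q1: "?q 1 = 1" by (rule qnum_1) (simp add: qeps_2_1)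
  have "qfall 1 2 (2 * p1 + 2 * p2 - of_nat 0 + 1) (0 + 1 + 1) \<noteq> 0"
    using assms unfolding cg_defined_def by (elim allE [of _ 0] allE [of _ 1]) simp
  then have nz: "?q (2 * p1 + 2 * p2 + 1) \<noteq> 0" "?q (2 * p1 + 2 * p2) \<noteq> 0"
    by (simp_all add: qfall_def)
  have SA: "{z. z < 2 \<and> 0 \<le> z + 1 \<and> z + 1 - 0 < 2} = {0::nat}"
    and SB: "{z. z < 2 \<and> 0 \<le> 1 + z \<and> 1 + z - 0 < 2} = {0::nat}" by auto
  have f: "qfact 1 2 0 = 1" "qfact 1 2 1 = 1" "qfact 1 2 (Suc 0) = 1"
    by (simp_all add: qfact_def q1)
  have r: "qfall_sqrt 1 2 x 0 = 1" "qfall_sqrt 1 2 x (Suc 0) = csqrt (?q x)"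
    "qfall_sqrt 1 2 x (Suc (Suc 0)) = csqrt (?q x) * csqrt (?q (x - 1))" for x
    by (simp_all add: qfall_sqrt_def lessThan_Suc)
  have e0: "?e 0 = 1" by (simp add: qeps_def)
  have A: "(clebsch_gordan 1 2 p1 p2 0 0 (Suc 0) (Suc 0))\<^sup>2 = (?e (- p1))\<^sup>2 * ?q (2 * p2) / ?q (2 * p1 + 2 * p2)"
    using nz by (simp add: clebsch_gordan_def f r e0 power_mult_distrib power_divide)
  have B: "(clebsch_gordan 1 2 p1 p2 0 (Suc 0) 0 (Suc 0))\<^sup>2 = (?e p2)\<^sup>2 * ?q (2 * p1) / ?q (2 * p1 + 2 * p2)"
    using nz by (simp add: clebsch_gordan_def f r e0 power_mult_distrib power_divide)
  have eA: "(?e (- p1))\<^sup>2 * ?e (2 * rho_printed 2 p1 0) = ?e (2 * p1)"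
    and eB: "(?e p2)\<^sup>2 * ?e (- 2 * rho_printed 2 p2 0) = ?e (- 2 * p2)"
    by (simp_all add: power2_eq_square qeps_add [symmetric] rho_printed_def)
  have e: "?e (2 * p1) = ?e (2 * (p1 + p2)) * ?e (- 2 * p2)"
    by (simp add: qeps_add [symmetric] ring_distribs)
  have "cg_A 1 2 (rho_printed 2) p1 p2 0 1
      = ((?e (- p1))\<^sup>2 * ?e (2 * rho_printed 2 p1 0)) * ?q (2 * p2) / ?q (2 * p1 + 2 * p2)"
    unfolding cg_A_def SA by (simp add: A)
  moreover have "cg_B 1 2 (rho_printed 2) p1 p2 0 1
      = ((?e p2)\<^sup>2 * ?e (- 2 * rho_printed 2 p2 0)) * ?q (2 * p1) / ?q (2 * p1 + 2 * p2)"
    unfolding cg_B_def SB by (simp add: B)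
  ultimately show ?thesis
    unfolding eA eB e using nz by (simp add: qfall_def)
qed

end

theory Submission
  imports Defs
begin

text \<open>
  Write \<open>a = 2 p\<^sub>1\<close>, \<open>b = 2 p\<^sub>2\<close>.  Clearing the square roots, \<open>C\<^sup>2\<close> is an explicit product times the
  square of a terminating \<open>q\<close>-hypergeometric sum, and that sum obeys two three-term recurrences
  (the intertwining relations for \<open>X\<^sup>+\<close> and \<open>X\<^sup>-\<close>).  Together they show that \<open>A\<close>, a partial quantum
  trace of the projection onto the summand with parameter \<open>p\<^sub>3\<close>, does not depend on \<open>z\<^sub>2\<close>.  At
  \<open>z\<^sub>2 = 0\<close> the hypergeometric sum has a single term, and since \<open>[N] = 0\<close> the remaining sum over
  \<open>z\<^sub>1\<close> terminates and is evaluated by the \<open>q\<close>-Vandermonde identity.  Replacing \<open>s\<close> by \<open>- s\<close>, which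
  inverts \<open>\<epsilon>\<close> but fixes every \<open>[x]\<close>, and exchanging the two factors turns \<open>B\<close> into such an \<open>A\<close>.
\<close>

subsection \<open>\<open>q\<close>-numbers\<close>

lemma qeps_0 [simp]: "qeps s N 0 = 1"
  by (simp add: qeps_def)

lemma qeps_minus: "qeps s N (- x) = inverse (qeps s N x)"
  by (simp add: qeps_def exp_minus)

lemma qeps_uminus_s: "qeps (- s) N x = qeps s N (- x)"
  by (simp add: qeps_def)

lemma qnum_uminus_s [simp]: "qnum (- s) N = qnum s N"
proof
  fix x
  show "qnum (- s) N x = qnum s N x"
    using minus_divide_divide[of "qeps s N x - qeps s N (- x)" "qeps s N 1 - qeps s N (- 1)"]
    by (simp add: qnum_def qeps_uminus_s)
qed

lemma qfact_uminus_s [simp]: "qfact (- s) N = qfact s N"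
  and qfall_uminus_s [simp]: "qfall (- s) N = qfall s N"
  by (simp_all add: qfact_def qfall_def fun_eq_iff)

lemma qnum_0 [simp]: "qnum s N 0 = 0"
  by (simp add: qnum_def)

lemma qnum_minus: "qnum s N (- x) = - qnum s N x"
  by (simp add: qnum_def minus_divide_left)

text \<open>Insert and remove epsilon^(y - x). This asymmetric form of the addition formula is the
  one that produces the Pascal rules.\<close>

lemma qnum_add: "qnum s N (x + y) = qnum s N x * qeps s N y + qeps s N (- x) * qnum s N y"
proof -
  have "qeps s N (x + y) - qeps s N (- (x + y))
     = (qeps s N x - qeps s N (- x)) * qeps s N y + qeps s N (- x) * (qeps s N y - qeps s N (- y))"
    by (simp add: left_diff_distrib right_diff_distrib flip: qeps_add)
  then show ?thesis
    by (simp add: qnum_def flip: add_divide_distrib)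
qed

lemma qfact_0 [simp]: "qfact s N 0 = 1"
  and qfact_Suc: "qfact s N (Suc m) = qfact s N m * qnum s N (of_nat (Suc m))"
  by (simp_all add: qfact_def)

lemma qfall_0 [simp]: "qfall s N x 0 = 1"
  and qfall_Suc: "qfall s N x (Suc m) = qfall s N x m * qnum s N (x - of_nat m)"
  by (simp_all add: qfall_def)

lemma qfall_add: "qfall s N x (m + k) = qfall s N x m * qfall s N (x - of_nat m) k"
  by (induction k) (simp_all add: qfall_Suc algebra_simps)

lemma qfall_Suc_left: "qfall s N x (Suc m) = qnum s N x * qfall s N (x - 1) m"
  using qfall_add[of s N x 1 m] by (simp add: qfall_def)

text \<open>Exact because roots are taken factor by factor; the principal root of a whole product
  would obey such a rule only up to sign.\<close>

lemma qfall_sqrt_add: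
  "qfall_sqrt s N x (m + k) = qfall_sqrt s N x m * qfall_sqrt s N (x - of_nat m) k"
  by (induction k) (simp_all add: qfall_sqrt_def algebra_simps)

lemma qfall_sqrt_power2 [simp]: "(qfall_sqrt s N x m)\<^sup>2 = qfall s N x m"
  by (simp add: qfall_sqrt_def qfall_def prod_power_distrib)

lemma qfall_sqrt_eq_0_iff [simp]: "qfall_sqrt s N x m = 0 \<longleftrightarrow> qfall s N x m = 0"
  by (simp add: qfall_sqrt_def qfall_def)

lemma qfall_of_nat_eq_0:
  assumes "z < m"
  shows "qfall s N (of_nat z) m = 0"
proof -
  have "qnum s N (of_nat z - of_nat z) = 0" by simp
  with assms show ?thesis unfolding qfall_def by (intro prod_zero bexI[of _ z]) auto
qed

text \<open>A quotient of factorials is a falling factorial; the product form survives vanishing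
  factors \<open>[k]\<close>.\<close>

lemma qfact_add: "qfact s N (m + k) = qfact s N m * qfall s N (of_nat (m + k)) k"
proof (induction k)
  case (Suc k)
  have "qfall s N (of_nat (m + Suc k)) (Suc k) = qnum s N (of_nat (m + Suc k)) * qfall s N (of_nat (m + k)) k"
    by (simp only: qfall_Suc_left) (simp add: algebra_simps)
  with Suc show ?case by (simp add: qfact_Suc del: of_nat_Suc of_nat_add)
qed simp

lemma qfall_nonzero_mono:
  assumes "qfall s N x m \<noteq> 0" "k \<le> m"
  shows "qfall s N x k \<noteq> 0"
  using assms qfall_add[of s N x k "m - k"] by auto

text \<open>The \<open>q\<close>-Pascal rule before division by \<open>[m]!\<close>: write the top
  entry \<open>x + 1\<close> as \<open>(x - (m - 1)) + m\<close> and apply the addition formula. For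
  \<open>m = 0\<close> the factor \<open>[0]\<close> removes the term with the truncated
  index.\<close>

lemma qfall_shift_plus:
  "qfall s N (x + 1) m = qeps s N (of_nat m) * qfall s N x m
     + qeps s N (of_nat m - x - 1) * qnum s N (of_nat m) * qfall s N x (m - 1)"
proof (cases m)
  case (Suc k)
  have "qnum s N (x + 1) = qnum s N ((x - of_nat k) + of_nat m)" by (simp add: Suc)
  also have "\<dots> = qnum s N (x - of_nat k) * qeps s N (of_nat m) + qeps s N (of_nat m - x - 1) * qnum s N (of_nat m)"
    by (subst qnum_add) (simp add: Suc algebra_simps)
  finally show ?thesis
    unfolding Suc by (simp only: qfall_Suc_left[of s N "x + 1"] qfall_Suc[of s N x]) (simp add: algebra_simps)
qed simp

lemma qfact_nonzero:
  assumes "\<And>k. 0 < k \<Longrightarrow> k \<le> n \<Longrightarrow> qnum s N (of_nat k) \<noteq> 0" "m \<le> n"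
  shows "qfact s N m \<noteq> 0"
  using assms by (auto simp: qfact_def)

subsection \<open>The hypergeometric sum and its recurrences\<close>

text \<open>At \<open>x = z1\<close>, \<open>y = z2\<close>, \<open>x' = 2 * p1 - z1\<close>,
  \<open>y' = 2 * p2 - z2\<close> this is, up to factors independent of \<nu>, the sum in the
  Clebsch-Gordan coefficient freed of roots. Four independent complex arguments give a meaning to
  \<open>z1 - 1\<close> at \<open>z1 = 0\<close>, and the falling factorials truncate the range by
  themselves.\<close>

definition qsum :: "int \<Rightarrow> nat \<Rightarrow> nat \<Rightarrow> complex \<Rightarrow> complex \<Rightarrow> complex \<Rightarrow> complex \<Rightarrow> complex" where
  "qsum s N n x y x' y' = (\<Sum>\<nu>\<le>n. (- 1) ^ \<nu> * qeps s N (- of_nat \<nu> * (x + y + x' + y' - of_nat n + 1))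
     * (qfall s N x' (n - \<nu>) * qfall s N y' \<nu> * qfall s N x \<nu> * qfall s N y (n - \<nu>))
     / (qfact s N \<nu> * qfact s N (n - \<nu>)))"

text \<open>Reversing the order of summation exchanges the two tensor factors; the powers of epsilon
  then run backwards, which \<open>- s\<close> absorbs.\<close>

lemma qsum_swap:
  "qsum s N n x y x' y'
     = (- 1) ^ n * qeps s N (- of_nat n * (x + y + x' + y' - of_nat n + 1)) * qsum (- s) N n y x y' x'"
proof -
  have "qsum s N n x y x' y' = (\<Sum>\<nu>\<le>n. (- 1) ^ (n - \<nu>) * qeps s N (- of_nat (n - \<nu>) * (x + y + x' + y' - of_nat n + 1))
     * (qfall s N x' \<nu> * qfall s N y' (n - \<nu>) * qfall s N x (n - \<nu>) * qfall s N y \<nu>)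
     / (qfact s N (n - \<nu>) * qfact s N \<nu>))"
    unfolding qsum_def
    by (rule sum.reindex_bij_witness[of _ "\<lambda>k. n - k" "\<lambda>k. n - k"]) auto
  also have "\<dots> = (\<Sum>\<nu>\<le>n. (- 1) ^ n * qeps s N (- of_nat n * (x + y + x' + y' - of_nat n + 1))
     * ((- 1) ^ \<nu> * qeps (- s) N (- of_nat \<nu> * (y + x + y' + x' - of_nat n + 1))
     * (qfall s N y' (n - \<nu>) * qfall s N x' \<nu> * qfall s N y \<nu> * qfall s N x (n - \<nu>))
     / (qfact s N \<nu> * qfact s N (n - \<nu>))))"
  proof (rule sum.cong)
    fix \<nu> assume "\<nu> \<in> {..n}"
    then have \<nu>: "\<nu> \<le> n" by simp
    then have 1: "(- 1) ^ (n - \<nu>) = (- 1) ^ n * (- 1 :: complex) ^ \<nu>"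
      by (simp add: minus_one_power_iff)
    have 2: "qeps s N (- of_nat (n - \<nu>) * (x + y + x' + y' - of_nat n + 1))
      = qeps s N (- of_nat n * (x + y + x' + y' - of_nat n + 1))
        * qeps (- s) N (- of_nat \<nu> * (y + x + y' + x' - of_nat n + 1))"
      unfolding qeps_uminus_s qeps_add[symmetric]
      by (rule arg_cong[where f="qeps s N"]) (use \<nu> in \<open>simp add: of_nat_diff algebra_simps\<close>)
    show "(- 1) ^ (n - \<nu>) * qeps s N (- of_nat (n - \<nu>) * (x + y + x' + y' - of_nat n + 1))
     * (qfall s N x' \<nu> * qfall s N y' (n - \<nu>) * qfall s N x (n - \<nu>) * qfall s N y \<nu>)
     / (qfact s N (n - \<nu>) * qfact s N \<nu>) = (- 1) ^ n * qeps s N (- of_nat n * (x + y + x' + y' - of_nat n + 1))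
     * ((- 1) ^ \<nu> * qeps (- s) N (- of_nat \<nu> * (y + x + y' + x' - of_nat n + 1))
     * (qfall s N y' (n - \<nu>) * qfall s N x' \<nu> * qfall s N y \<nu> * qfall s N x (n - \<nu>))
     / (qfact s N \<nu> * qfact s N (n - \<nu>)))"
      unfolding 1 2 by (simp add: ac_simps)
  qed simp
  finally show ?thesis
    by (simp add: qsum_def sum_distrib_left)
qed

text \<open>A nonzero summand needs \<open>\<nu> <= z1\<close> and \<open>n - \<nu> <= z2\<close>,
  hence \<open>n <= z1 + z2\<close>.\<close>

lemma qsum_eq_0:
  assumes "z1 + z2 < n"
  shows "qsum s N n (of_nat z1) (of_nat z2) x' y' = 0"
  unfolding qsum_def
proof (rule sum.neutral, rule ballI)
  fix \<nu> assume "\<nu> \<in> {..n}"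
  show "(- 1) ^ \<nu> * qeps s N (- of_nat \<nu> * (of_nat z1 + of_nat z2 + x' + y' - of_nat n + 1))
     * (qfall s N x' (n - \<nu>) * qfall s N y' \<nu> * qfall s N (of_nat z1) \<nu> * qfall s N (of_nat z2) (n - \<nu>))
     / (qfact s N \<nu> * qfact s N (n - \<nu>)) = 0"
  proof (cases "z1 < \<nu>")
    case False
    then have "z2 < n - \<nu>" using assms by simp
    then show ?thesis by (simp add: qfall_of_nat_eq_0)
  qed (simp add: qfall_of_nat_eq_0)
qed

text \<open>The \<open>q\<close>-binomial coefficient with a complex upper entry.\<close>

definition qdiv :: "int \<Rightarrow> nat \<Rightarrow> complex \<Rightarrow> nat \<Rightarrow> complex" where
  "qdiv s N x m = qfall s N x m / qfact s N m"

lemma qdiv_shift_plus: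
  assumes "qfact s N m \<noteq> 0"
  shows "qdiv s N (x + 1) m = qeps s N (of_nat m) * qdiv s N x m
     + (if m = 0 then 0 else qeps s N (of_nat m - x - 1) * qdiv s N x (m - 1))"
proof (cases m)
  case (Suc k)
  with assms have "qfact s N k \<noteq> 0" "qnum s N (of_nat m) \<noteq> 0" "qfact s N m = qfact s N k * qnum s N (of_nat m)"
    by (auto simp: qfact_Suc)
  then show ?thesis
    unfolding qdiv_def qfall_shift_plus by (simp add: Suc add_divide_distrib)
qed (simp add: qdiv_def)

text \<open>The other Pascal rule: the first one with epsilon inverted, since \<open>qdiv\<close> is
  the same for \<open>s\<close> and \<open>- s\<close>.\<close>

lemma qdiv_shift_minus:
  assumes "qfact s N m \<noteq> 0"
  shows "qdiv s N (x + 1) m = qeps s N (- of_nat m) * qdiv s N x m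
     + (if m = 0 then 0 else qeps s N (x + 1 - of_nat m) * qdiv s N x (m - 1))"
  using qdiv_shift_plus[of "- s" N m x] assms by (simp add: qdiv_def qeps_uminus_s algebra_simps)

text \<open>An intertwining relation: the paired shifts lower \<open>z1\<close> or \<open>z2\<close>
  while \<open>2 * p1\<close> and \<open>2 * p2\<close> stay fixed. One Pascal rule is applied at
  \<open>x' + 1\<close>, the opposite one at \<open>y' + 1\<close>; the leading parts add up to the
  right-hand side and the rest telescopes.\<close>

lemma qsum_recurrence:
  fixes x y x' y' :: complex
  assumes nz: "\<And>k. 0 < k \<Longrightarrow> k \<le> n \<Longrightarrow> qnum s N (of_nat k) \<noteq> 0"
  shows "qeps s N (- y) * qnum s N x * qsum s N n (x - 1) y (x' + 1) y'
       + qeps s N x * qnum s N y * qsum s N n x (y - 1) x' (y' + 1)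
       = qnum s N (x + y - of_nat n) * qsum s N n x y x' y'"
proof -
  \<comment> \<open>The shifts preserve \<open>x + y + x' + y'\<close>, so all three sums carry the
    same powers of epsilon.\<close>
  define \<kappa> where "\<kappa> = x + y + x' + y' - of_nat n + 1"
  have \<kappa>: "(x - 1) + y + (x' + 1) + y' - of_nat n + 1 = \<kappa>"
    "x + (y - 1) + x' + (y' + 1) - of_nat n + 1 = \<kappa>"
    by (simp_all add: \<kappa>_def)
  define E where "E \<nu> = (- 1) ^ \<nu> * qeps s N (- of_nat \<nu> * \<kappa>)" for \<nu>
  define D where "D = qdiv s N"
  define P where "P = qfall s N"
  define T where "T \<nu> = E \<nu> * D x' (n - \<nu>) * D y' \<nu> * P x \<nu> * P y (n - \<nu>)" for \<nu>
  define T1 where "T1 \<nu> = E \<nu> * D (x' + 1) (n - \<nu>) * D y' \<nu> * P (x - 1) \<nu> * P y (n - \<nu>)" for \<nu>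
  define T2 where "T2 \<nu> = E \<nu> * D x' (n - \<nu>) * D (y' + 1) \<nu> * P x \<nu> * P (y - 1) (n - \<nu>)" for \<nu>
  \<comment> \<open>The parts of the two shifted summands which are not multiples of \<open>T \<nu>\<close> telescope.\<close>
  define R where "R \<nu> = (if \<nu> = 0 \<or> \<nu> > n then 0 else
     - (E \<nu> * qeps s N (x + y' + 1 - of_nat \<nu>) * D x' (n - \<nu>) * D y' (\<nu> - 1) * P x \<nu> * P y (n - \<nu> + 1)))" for \<nu>
  have S: "qsum s N n x y x' y' = sum T {..<Suc n}"
    "qsum s N n (x - 1) y (x' + 1) y' = sum T1 {..<Suc n}"
    "qsum s N n x (y - 1) x' (y' + 1) = sum T2 {..<Suc n}"
    unfolding qsum_def T_def T1_def T2_def \<kappa> \<kappa>_def[symmetric] lessThan_Suc_atMost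
    by (auto intro!: sum.cong simp: E_def D_def P_def qdiv_def ac_simps)
  have step: "qeps s N (- y) * qnum s N x * T1 \<nu> + qeps s N x * qnum s N y * T2 \<nu>
     = qnum s N (x + y - of_nat n) * T \<nu> + (R (Suc \<nu>) - R \<nu>)" if "\<nu> \<le> n" for \<nu>
  proof -
    define m where "m = n - \<nu>"
    have n: "n = m + \<nu>" using that by (simp add: m_def)
    have f: "qfact s N m \<noteq> 0" "qfact s N \<nu> \<noteq> 0"
      by (simp_all add: qfact_nonzero[OF nz] n)
    \<comment> \<open>Each product of length \<open>\<nu> + 1\<close> (or \<open>m + 1\<close>) is
      split at its first and at its last factor.\<close>
    have Px: "qnum s N x * P (x - 1) \<nu> = P x \<nu> * qnum s N (x - of_nat \<nu>)"
      and Py: "qnum s N y * P (y - 1) m = P y m * qnum s N (y - of_nat m)"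
      unfolding P_def qfall_Suc_left[symmetric] qfall_Suc by simp_all
    \<comment> \<open>Since \<open>n = m + \<nu>\<close>, the argument is
      \<open>(y - m) + (x - \<nu>)\<close>. The two terms are the coefficients of
      \<open>T \<nu>\<close> left by the leading Pascal parts.\<close>
    have main: "qnum s N (x + y - of_nat n) = qeps s N (- y) * qnum s N (x - of_nat \<nu>) * qeps s N (of_nat m)
        + qeps s N x * qnum s N (y - of_nat m) * qeps s N (- of_nat \<nu>)"
    proof -
      have "qnum s N (x + y - of_nat n) = qnum s N ((y - of_nat m) + (x - of_nat \<nu>))"
        by (simp add: n algebra_simps)
      then show ?thesis
        using qeps_add[of s N x "- of_nat \<nu>"] qeps_add[of s N "- y" "of_nat m"] by (simp add: qnum_add)
    qed
    have d1: "D (x' + 1) m = qeps s N (of_nat m) * D x' m + (if m = 0 then 0 else qeps s N (of_nat m - x' - 1) * D x' (m - 1))"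
      unfolding D_def by (rule qdiv_shift_plus) fact
    have d2: "D (y' + 1) \<nu> = qeps s N (- of_nat \<nu>) * D y' \<nu> + (if \<nu> = 0 then 0 else qeps s N (y' + 1 - of_nat \<nu>) * D y' (\<nu> - 1))"
      unfolding D_def by (rule qdiv_shift_minus) fact
    \<comment> \<open>\<open>R (Suc \<nu>)\<close> is the second Pascal part of the
      \<open>T1\<close> term, and \<open>- R \<nu>\<close> that of the \<open>T2\<close> term. The
      minus sign in \<open>R\<close> is offset by the additional \<open>- 1\<close> in
      \<open>E (Suc \<nu>)\<close>.\<close>
    have r1: "R (Suc \<nu>) = E \<nu> * (if m = 0 then 0 else qeps s N (- y) * qeps s N (of_nat m - x' - 1) * D x' (m - 1))
         * D y' \<nu> * (P x \<nu> * qnum s N (x - of_nat \<nu>)) * P y m"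
    proof (cases m)
      case 0 then show ?thesis by (simp add: R_def n)
    next
      case (Suc k)
      have "- (qeps s N (- of_nat (Suc \<nu>) * \<kappa>) * qeps s N (x + y' + 1 - of_nat (Suc \<nu>)))
         = - (qeps s N (- of_nat \<nu> * \<kappa>) * (qeps s N (- y) * qeps s N (of_nat m - x' - 1)))"
        unfolding qeps_add[symmetric]
        by (rule arg_cong[where f="\<lambda>z. - qeps s N z"]) (simp add: n \<kappa>_def algebra_simps)
      then have "- (E (Suc \<nu>) * qeps s N (x + y' + 1 - of_nat (Suc \<nu>))) = E \<nu> * (qeps s N (- y) * qeps s N (of_nat m - x' - 1))"
        unfolding E_def by (simp add: mult.assoc)
      moreover have "P x (Suc \<nu>) = P x \<nu> * qnum s N (x - of_nat \<nu>)" by (simp add: P_def qfall_Suc)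
      moreover have "R (Suc \<nu>) = - (E (Suc \<nu>) * qeps s N (x + y' + 1 - of_nat (Suc \<nu>))) * D x' k * D y' \<nu> * P x (Suc \<nu>) * P y m"
        by (simp add: R_def n Suc)
      ultimately show ?thesis by (simp add: Suc)
    qed
    have r2: "R \<nu> = - (E \<nu> * D x' m * (if \<nu> = 0 then 0 else qeps s N x * qeps s N (y' + 1 - of_nat \<nu>) * D y' (\<nu> - 1))
         * P x \<nu> * (P y m * qnum s N (y - of_nat m)))"
    proof (cases "\<nu> = 0")
      case False
      have "qeps s N (x + y' + 1 - of_nat \<nu>) = qeps s N x * qeps s N (y' + 1 - of_nat \<nu>)"
        by (simp add: algebra_simps flip: qeps_add)
      with False show ?thesis by (simp add: R_def n P_def qfall_Suc)
    qed (simp add: R_def)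
    have "qeps s N (- y) * qnum s N x * T1 \<nu> + qeps s N x * qnum s N y * T2 \<nu>
      = qeps s N (- y) * E \<nu> * D (x' + 1) m * D y' \<nu> * (qnum s N x * P (x - 1) \<nu>) * P y m
        + qeps s N x * E \<nu> * D x' m * D (y' + 1) \<nu> * P x \<nu> * (qnum s N y * P (y - 1) m)"
      by (simp add: T1_def T2_def m_def)
    also have "\<dots> = qnum s N (x + y - of_nat n) * T \<nu> + (R (Suc \<nu>) - R \<nu>)"
      unfolding Px Py d1 d2 r1 r2 main T_def m_def[symmetric] by (simp add: algebra_simps)
    finally show ?thesis .
  qed
  have "qeps s N (- y) * qnum s N x * sum T1 {..<Suc n} + qeps s N x * qnum s N y * sum T2 {..<Suc n}
     = (\<Sum>\<nu><Suc n. qeps s N (- y) * qnum s N x * T1 \<nu> + qeps s N x * qnum s N y * T2 \<nu>)"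
    by (simp only: sum.distrib sum_distrib_left)
  also have "\<dots> = (\<Sum>\<nu><Suc n. qnum s N (x + y - of_nat n) * T \<nu> + (R (Suc \<nu>) - R \<nu>))"
    by (rule sum.cong) (use step in auto)
  also have "\<dots> = qnum s N (x + y - of_nat n) * sum T {..<Suc n} + (R (Suc n) - R 0)"
    by (simp only: sum.distrib sum_distrib_left sum_lessThan_telescope)
  \<comment> \<open>The cut-offs in \<open>R\<close> make both ends of the telescoping sum
    zero.\<close>
  also have "R (Suc n) - R 0 = 0" by (simp add: R_def)
  finally show ?thesis unfolding S by simp
qed

text \<open>Up to a factor, reversing the summation also exchanges \<open>(x, y)\<close> with
  \<open>(x', y')\<close> and inverts epsilon. The factor depends only on \<open>n\<close> and the
  sum of the arguments, hence is common to all three terms.\<close>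

lemma qsum_recurrence_dual:
  fixes x y x' y' :: complex
  assumes nz: "\<And>k. 0 < k \<Longrightarrow> k \<le> n \<Longrightarrow> qnum s N (of_nat k) \<noteq> 0"
  shows "qeps s N y' * qnum s N x' * qsum s N n (x + 1) y (x' - 1) y'
       + qeps s N (- x') * qnum s N y' * qsum s N n x (y + 1) x' (y' - 1)
       = qnum s N (x' + y' - of_nat n) * qsum s N n x y x' y'"
proof -
  have dual: "qsum s N n x y x' y' = (- 1) ^ n * qeps s N (- of_nat n * (x + y + x' + y' - of_nat n + 1))
    * qsum (- s) N n x' y' x y" for x y x' y'
    unfolding qsum_swap[of s N n x y x' y'] by (simp add: qsum_def ac_simps)
  show ?thesis
    unfolding dual[of "x + 1"] dual[of x "y + 1"] dual[of x y x' y']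
    using arg_cong[OF qsum_recurrence[of n "- s" N y' x' x y],
      of "\<lambda>u. (- 1) ^ n * qeps s N (- of_nat n * (x + y + x' + y' - of_nat n + 1)) * u"] nz
    by (simp add: qeps_uminus_s algebra_simps)
qed

subsection \<open>The \<open>q\<close>-Vandermonde identity\<close>

text \<open>Induction with \<alpha> free: a Pascal rule splits the sum for \<open>m + 1\<close> into
  the sum for \<open>m\<close> at \<alpha> and a multiple of the one at
  \<open>\<alpha> - 1\<close>.\<close>

lemma q_vandermonde:
  assumes nz: "\<And>k. 0 < k \<Longrightarrow> k \<le> m \<Longrightarrow> qnum s N (of_nat k) \<noteq> 0"
    and "qfall s N (\<alpha> + \<beta>) m \<noteq> 0"
  shows "(\<Sum>j\<le>m. (- 1) ^ j * qeps s N (of_nat j * (\<beta> - of_nat m + 1)) * qdiv s N (of_nat m) j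
            * qfall s N \<alpha> j / qfall s N (\<alpha> + \<beta>) j)
         = qeps s N (- of_nat m * \<alpha>) * qfall s N \<beta> m / qfall s N (\<alpha> + \<beta>) m"
  using assms
proof (induction m arbitrary: \<alpha>)
  case 0
  then show ?case by (simp add: qdiv_def)
next
  case (Suc m)
  define V where "V m \<alpha> = (\<Sum>j\<le>m. (- 1) ^ j * qeps s N (of_nat j * (\<beta> - of_nat m + 1)) * qdiv s N (of_nat m) j
            * qfall s N \<alpha> j / qfall s N (\<alpha> + \<beta>) j)" for m \<alpha>
  define W where "W = qfall s N (\<alpha> + \<beta>) (Suc m)"
  \<comment> \<open>Splitting off the last or the first factor shows that the denominators of both
    induction hypotheses are nonzero.\<close>
  have W: "W = qfall s N (\<alpha> + \<beta>) m * qnum s N (\<alpha> + \<beta> - of_nat m)"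
    "W = qnum s N (\<alpha> + \<beta>) * qfall s N (\<alpha> - 1 + \<beta>) m"
    unfolding W_def by (rule qfall_Suc, simp add: qfall_Suc_left algebra_simps)
  have "W \<noteq> 0" using Suc.prems by (simp add: W_def)
  with W have W0: "qfall s N (\<alpha> + \<beta>) m \<noteq> 0" "qfall s N (\<alpha> - 1 + \<beta>) m \<noteq> 0" "qnum s N (\<alpha> + \<beta>) \<noteq> 0"
    "qnum s N (\<alpha> + \<beta> - of_nat m) \<noteq> 0"
    by auto
  have IH: "V m \<alpha> = qeps s N (- of_nat m * \<alpha>) * qfall s N \<beta> m / qfall s N (\<alpha> + \<beta>) m"
    "V m (\<alpha> - 1) = qeps s N (- of_nat m * (\<alpha> - 1)) * qfall s N \<beta> m / qfall s N (\<alpha> - 1 + \<beta>) m"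
    unfolding V_def by (rule Suc.IH; use Suc.prems(1) W0 in simp)+
  define D where "D = qdiv s N (of_nat m)"
  define r where "r j = (- 1) ^ j * qfall s N \<alpha> j / qfall s N (\<alpha> + \<beta>) j" for j
  have pascal: "qdiv s N (of_nat (Suc m)) j = qeps s N (of_nat j) * D j
      + (if j = 0 then 0 else qeps s N (of_nat j - of_nat m - 1) * D (j - 1))" if "j \<le> Suc m" for j
    using qdiv_shift_plus[of s N j "of_nat m"] qfact_nonzero[OF Suc.prems(1) that]
    by (simp add: D_def add.commute)
  \<comment> \<open>So the first Pascal part stops at \<open>j = m\<close>; the second starts at
    \<open>j = 1\<close> and is reindexed.\<close>
  have DSuc: "D (Suc m) = 0"
    by (simp add: D_def qdiv_def qfall_of_nat_eq_0)
  have "V (Suc m) \<alpha> = (\<Sum>j\<le>Suc m. r j * qeps s N (of_nat j * (\<beta> - of_nat (Suc m) + 1)) * qdiv s N (of_nat (Suc m)) j)"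
    unfolding V_def by (intro sum.cong refl) (simp add: r_def ac_simps)
  also have "\<dots> = (\<Sum>j\<le>Suc m. r j * qeps s N (of_nat j * (\<beta> - of_nat (Suc m) + 1)) * (qeps s N (of_nat j) * D j))
     + (\<Sum>j\<le>Suc m. r j * qeps s N (of_nat j * (\<beta> - of_nat (Suc m) + 1))
          * (if j = 0 then 0 else qeps s N (of_nat j - of_nat m - 1) * D (j - 1)))"
    unfolding sum.distrib[symmetric]
    by (intro sum.cong refl, subst pascal) (simp_all only: distrib_left atMost_iff)
  also have "(\<Sum>j\<le>Suc m. r j * qeps s N (of_nat j * (\<beta> - of_nat (Suc m) + 1)) * (qeps s N (of_nat j) * D j))
     = (\<Sum>j\<le>m. r j * qeps s N (of_nat j * (\<beta> - of_nat (Suc m) + 1)) * (qeps s N (of_nat j) * D j))"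
    by (simp add: DSuc)
  also have "\<dots> = V m \<alpha>"
    unfolding V_def
  proof (intro sum.cong refl)
    fix j
    have "qeps s N (of_nat j * (\<beta> - of_nat (Suc m) + 1)) * qeps s N (of_nat j) = qeps s N (of_nat j * (\<beta> - of_nat m + 1))"
      by (simp add: algebra_simps flip: qeps_add)
    then show "r j * qeps s N (of_nat j * (\<beta> - of_nat (Suc m) + 1)) * (qeps s N (of_nat j) * D j)
      = (- 1) ^ j * qeps s N (of_nat j * (\<beta> - of_nat m + 1)) * qdiv s N (of_nat m) j
            * qfall s N \<alpha> j / qfall s N (\<alpha> + \<beta>) j"
      by (simp add: r_def D_def mult.assoc[symmetric])
  qed
  also have "(\<Sum>j\<le>Suc m. r j * qeps s N (of_nat j * (\<beta> - of_nat (Suc m) + 1))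
          * (if j = 0 then 0 else qeps s N (of_nat j - of_nat m - 1) * D (j - 1)))
     = (\<Sum>j\<le>m. r (Suc j) * qeps s N (of_nat (Suc j) * (\<beta> - of_nat (Suc m) + 1))
          * (qeps s N (of_nat (Suc j) - of_nat m - 1) * D j))"
    by (subst sum.atMost_Suc_shift) simp
  also have "\<dots> = - qeps s N (\<beta> - 2 * of_nat m) * qnum s N \<alpha> / qnum s N (\<alpha> + \<beta>) * V m (\<alpha> - 1)"
    unfolding V_def sum_distrib_left
  proof (intro sum.cong refl)
    fix j
    have 1: "qeps s N (of_nat (Suc j) * (\<beta> - of_nat (Suc m) + 1)) * qeps s N (of_nat (Suc j) - of_nat m - 1)
       = qeps s N (\<beta> - 2 * of_nat m) * qeps s N (of_nat j * (\<beta> - of_nat m + 1))"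
      by (simp add: algebra_simps flip: qeps_add)
    have 2: "r (Suc j) = - (qnum s N \<alpha> / qnum s N (\<alpha> + \<beta>))
        * ((- 1) ^ j * qfall s N (\<alpha> - 1) j / qfall s N (\<alpha> - 1 + \<beta>) j)"
      by (simp add: r_def qfall_Suc_left algebra_simps)
    have "r (Suc j) * qeps s N (of_nat (Suc j) * (\<beta> - of_nat (Suc m) + 1)) * (qeps s N (of_nat (Suc j) - of_nat m - 1) * D j)
      = r (Suc j) * (qeps s N (of_nat (Suc j) * (\<beta> - of_nat (Suc m) + 1)) * qeps s N (of_nat (Suc j) - of_nat m - 1)) * D j"
      by (simp only: ac_simps)
    then show "r (Suc j) * qeps s N (of_nat (Suc j) * (\<beta> - of_nat (Suc m) + 1))
          * (qeps s N (of_nat (Suc j) - of_nat m - 1) * D j)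
      = - qeps s N (\<beta> - 2 * of_nat m) * qnum s N \<alpha> / qnum s N (\<alpha> + \<beta>)
        * ((- 1) ^ j * qeps s N (of_nat j * (\<beta> - of_nat m + 1)) * qdiv s N (of_nat m) j
            * qfall s N (\<alpha> - 1) j / qfall s N (\<alpha> - 1 + \<beta>) j)"
      unfolding 1 2 by (simp add: D_def)
  qed
  also have "V m \<alpha> + - qeps s N (\<beta> - 2 * of_nat m) * qnum s N \<alpha> / qnum s N (\<alpha> + \<beta>) * V m (\<alpha> - 1)
     = qeps s N (- of_nat (Suc m) * \<alpha>) * qfall s N \<beta> (Suc m) / W"
  proof -
    have e1: "qeps s N (\<beta> - 2 * of_nat m) * qeps s N (- of_nat m * (\<alpha> - 1)) = qeps s N (- of_nat m * \<alpha>) * qeps s N (\<beta> - of_nat m)"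
      by (simp add: algebra_simps flip: qeps_add)
    have e2: "qeps s N (- of_nat (Suc m) * \<alpha>) = qeps s N (- of_nat m * \<alpha>) * qeps s N (- \<alpha>)"
      by (simp add: algebra_simps flip: qeps_add)
    \<comment> \<open>Its \<open>[\<alpha>]\<close> term cancels against the sum at
      \<open>\<alpha> - 1\<close>; the remaining \<open>[\<beta> - m]\<close> prolongs the falling
      product of \<beta>.\<close>
    have q: "qnum s N (\<alpha> + \<beta> - of_nat m) = qnum s N \<alpha> * qeps s N (\<beta> - of_nat m) + qeps s N (- \<alpha>) * qnum s N (\<beta> - of_nat m)"
      using qnum_add[of s N \<alpha> "\<beta> - of_nat m"] by (simp add: add_diff_eq)
    have a: "V m \<alpha> = qeps s N (- of_nat m * \<alpha>) * qfall s N \<beta> m * qnum s N (\<alpha> + \<beta> - of_nat m) / W"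
      using W0 by (simp add: IH W(1))
    have "qeps s N (\<beta> - 2 * of_nat m) * qnum s N \<alpha> / qnum s N (\<alpha> + \<beta>) * V m (\<alpha> - 1)
      = (qeps s N (\<beta> - 2 * of_nat m) * qeps s N (- of_nat m * (\<alpha> - 1))) * qfall s N \<beta> m * qnum s N \<alpha> / W"
      by (simp add: IH W(2))
    then have b: "qeps s N (\<beta> - 2 * of_nat m) * qnum s N \<alpha> / qnum s N (\<alpha> + \<beta>) * V m (\<alpha> - 1)
      = qeps s N (- of_nat m * \<alpha>) * qfall s N \<beta> m * (qeps s N (\<beta> - of_nat m) * qnum s N \<alpha>) / W"
      unfolding e1 by (simp add: ac_simps)
    have "V m \<alpha> - qeps s N (\<beta> - 2 * of_nat m) * qnum s N \<alpha> / qnum s N (\<alpha> + \<beta>) * V m (\<alpha> - 1)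
      = qeps s N (- of_nat (Suc m) * \<alpha>) * qfall s N \<beta> (Suc m) / W"
      unfolding b a e2 q qfall_Suc diff_divide_distrib[symmetric] by (simp add: algebra_simps)
    then show ?thesis by simp
  qed
  finally show ?case
    by (simp add: V_def W_def)
qed

subsection \<open>Roots of unity\<close>

lemma qeps_period:
  assumes "N > 0"
  shows "qeps s N (2 * of_nat N * of_int k) = 1"
proof -
  have "of_real pi * \<i> * of_int s * (2 * of_nat N * of_int k) / of_nat N = 2 * of_int (s * k) * of_real pi * \<i>"
    using assms by (simp add: field_simps)
  then show ?thesis
    using exp_integer_2pi[of "of_int (s * k)"] by (simp add: qeps_def ac_simps)
qed

lemma qnum_multiple: "qnum s N (of_nat N * of_int k) = 0"
proof (cases "N = 0")
  case False
  then have "qeps s N (of_nat N * of_int k) * qeps s N (of_nat N * of_int k) = 1"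
    using qeps_period[of N s k] by (simp add: algebra_simps flip: qeps_add)
  then show ?thesis
    by (simp add: qnum_def qeps_minus) (metis inverse_unique)
qed simp

lemma qnum_shift_multiple_eq_0_iff:
  "qnum s N (x + of_nat N * of_int k) = 0 \<longleftrightarrow> qnum s N x = 0"
  by (simp add: qnum_add qnum_multiple)

text \<open>As \<open>[N] = 0\<close>, only one term of the addition formula survives.\<close>

lemma qnum_reflect: "qnum s N (of_nat N - x) = - qeps s N (- of_nat N) * qnum s N x"
  using qnum_add[of s N "of_nat N" "- x"] qnum_multiple[of s N 1] by (simp add: qnum_minus)

lemma qnum_of_nat_nonzero:
  assumes "coprime s (int N)" "0 < k" "k < N"
  shows "qnum s N (of_nat k) \<noteq> 0"
proof -
  \<comment> \<open>Equality would make \<open>N\<close> divide \<open>s * j\<close>, hence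
    \<open>j\<close>. The case \<open>j = k\<close> serves the numerator of \<open>[k]\<close>, the
    case \<open>j = 1\<close> its denominator.\<close>
  have *: "qeps s N (of_nat j) \<noteq> qeps s N (- of_nat j)" if "0 < j" "j < N" for j
  proof
    assume "qeps s N (of_nat j) = qeps s N (- of_nat j)"
    then have "qeps s N (of_nat j) * qeps s N (of_nat j) = qeps s N (- of_nat j) * qeps s N (of_nat j)"
      by (rule arg_cong[where f="\<lambda>u. u * qeps s N (of_nat j)"])
    then have "qeps s N (2 * of_nat j) = 1"
      by (simp flip: qeps_add)
    then obtain l :: int where "pi * of_int s * (2 * of_nat j) / of_nat N = of_int (2 * l) * pi"
      unfolding qeps_def exp_eq_1 by (auto simp: Im_divide_of_nat)
    then have "of_int s * of_nat j = (of_int l * of_nat N :: real)"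
      using that by (simp add: field_simps)
    then have "s * int j = l * int N"
      by (metis of_int_eq_iff of_int_mult of_int_of_nat_eq)
    then have "int N dvd s * int j" by simp
    then have "int N dvd int j"
      using assms(1) by (simp add: coprime_commute coprime_dvd_mult_right_iff)
    then show False using that by (auto dest: dvd_imp_le)
  qed
  show ?thesis
    unfolding qnum_def using *[of k] *[of 1] assms by simp
qed

lemma qfact_eq_0:
  assumes "N > 0" "m \<ge> N"
  shows "qfact s N m = 0"
  unfolding qfact_def using assms qnum_multiple[of s N 1] by (intro prod_zero bexI[of _ N]) auto

subsection \<open>Independence of the fixed index\<close>

definition cg_poly :: "int \<Rightarrow> nat \<Rightarrow> nat \<Rightarrow> complex \<Rightarrow> complex \<Rightarrow> nat \<Rightarrow> nat \<Rightarrow> complex" where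
  "cg_poly s N n a b z1 z2 = qsum s N n (of_nat z1) (of_nat z2) (a - of_nat z1) (b - of_nat z2)"

text \<open>Up to the factor \<open>cg_norm\<close>, this is the squared coefficient times
  epsilon^(2 z1), the part of the weight in \<open>A\<close> that varies with
  \<open>z1\<close>.\<close>

definition cg_term :: "int \<Rightarrow> nat \<Rightarrow> nat \<Rightarrow> complex \<Rightarrow> complex \<Rightarrow> nat \<Rightarrow> nat \<Rightarrow> complex" where
  "cg_term s N n a b z1 z2 = qeps s N (of_nat z1 * b - of_nat z2 * a + 2 * of_nat z1)
     * (qfact s N (z1 + z2 - n) * qfall s N a z1 * qfall s N b z2)
     / (qfact s N z1 * qfact s N z2 * qfall s N (a + b - of_nat n + 1) (z1 + z2 + 1))
     * (cg_poly s N n a b z1 z2)\<^sup>2"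

lemma cg_poly_eq_0: "z1 + z2 < n \<Longrightarrow> cg_poly s N n a b z1 z2 = 0"
  by (simp add: cg_poly_def qsum_eq_0)

text \<open>The sums may thus run over all indices below \<open>N\<close>: a negative
  \<open>z3\<close> is killed by the hypergeometric sum, \<open>z3 >= N\<close> by the factor
  \<open>[N] = 0\<close> of \<open>[z3]!\<close>.\<close>

lemma cg_term_eq_0: "N > 0 \<Longrightarrow> z1 + z2 < n \<or> z1 + z2 - n \<ge> N \<Longrightarrow> cg_term s N n a b z1 z2 = 0"
  by (auto simp: cg_term_def cg_poly_eq_0 qfact_eq_0)

lemma cg_term_nonzeroD:
  assumes "cg_term s N n a b z1 z2 \<noteq> 0" "n < N"
  shows "n \<le> z1 + z2" "z1 + z2 - n < N"
  using assms cg_term_eq_0[of N z1 z2 n s a b] by force+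

lemma cg_poly_swap:
  "cg_poly s N n a b z1 z2
     = (- 1) ^ n * qeps s N (- of_nat n * (a + b - of_nat n + 1)) * cg_poly (- s) N n b a z2 z1"
  unfolding cg_poly_def by (subst qsum_swap) simp

text \<open>This turns summands of \<open>B\<close> into summands of \<open>A\<close>: the sign from
  \<open>cg_poly_swap\<close> disappears on squaring and its power of epsilon doubles.\<close>

lemma cg_term_swap:
  "qeps s N (- 2 * of_nat z1) * cg_term s N n a b z1 z2
    = qeps s N (- 2 * of_nat n * (a + b - of_nat n + 1)) * (qeps s N (2 * of_nat z2) * cg_term (- s) N n b a z2 z1)"
proof -
  define M where "M = qfact s N (z1 + z2 - n) * qfall s N a z1 * qfall s N b z2
     / (qfact s N z1 * qfact s N z2 * qfall s N (a + b - of_nat n + 1) (z1 + z2 + 1)) * (cg_poly (- s) N n b a z2 z1)\<^sup>2"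
  have 1: "cg_term s N n a b z1 z2 = qeps s N (of_nat z1 * b - of_nat z2 * a + 2 * of_nat z1)
     * (qeps s N (- of_nat n * (a + b - of_nat n + 1)) * qeps s N (- of_nat n * (a + b - of_nat n + 1))) * M"
    by (simp add: cg_term_def cg_poly_swap[of s] M_def power_mult_distrib power2_eq_square)
  have 2: "cg_term (- s) N n b a z2 z1 = qeps s N (of_nat z1 * b - of_nat z2 * a - 2 * of_nat z2) * M"
    by (simp add: cg_term_def M_def qeps_uminus_s algebra_simps)
  have 3: "qeps s N (- 2 * of_nat z1) * (qeps s N (of_nat z1 * b - of_nat z2 * a + 2 * of_nat z1)
     * (qeps s N (- of_nat n * (a + b - of_nat n + 1)) * qeps s N (- of_nat n * (a + b - of_nat n + 1))))
    = qeps s N (- 2 * of_nat n * (a + b - of_nat n + 1)) * (qeps s N (2 * of_nat z2)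
       * qeps s N (of_nat z1 * b - of_nat z2 * a - 2 * of_nat z2))"
    unfolding qeps_add[symmetric] by (rule arg_cong[where f="qeps s N"]) (simp add: algebra_simps)
  show ?thesis
    unfolding 1 2 using arg_cong[OF 3, of "\<lambda>u. u * M"] by (simp only: mult.assoc)
qed

lemma qnum_times_div_qfact_Suc:
  assumes "qnum s N (of_nat (Suc m)) \<noteq> 0"
  shows "qnum s N (of_nat (Suc m)) / qfact s N (Suc m) = 1 / qfact s N m"
  using assms by (simp add: qfact_Suc)

text \<open>Both recurrences, suitably weighted, express one and the same product of neighbouring
  values of \<open>t\<close>. Equating them relates the summands at \<open>z2\<close> and
  \<open>Suc z2\<close> up to off-diagonal terms, whose sums over \<open>z1\<close>
  coincide.\<close>

lemma sum_cg_term_Suc: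
  assumes "n < N" "Suc z2 < N"
    and nz: "\<And>k. 0 < k \<Longrightarrow> k < N \<Longrightarrow> qnum s N (of_nat k) \<noteq> 0"
    and generic: "\<And>j :: int. qnum s N (a + b + of_int j) \<noteq> 0"
  shows "(\<Sum>z1<N. cg_term s N n a b z1 z2) = (\<Sum>z1<N. cg_term s N n a b z1 (Suc z2))"
proof -
  define F where "F m = qfall s N (a + b - of_nat n + 1) m" for m
  have c0: "qnum s N (a + b + of_nat n - of_nat z1 - of_nat z2) \<noteq> 0" for z1
    using generic[of "int n - int z1 - int z2"] by (simp add: algebra_simps)
  have F0: "F m \<noteq> 0" for m
  proof -
    have "qnum s N (a + b - of_nat n + 1 - of_nat k) \<noteq> 0" for k
      using generic[of "1 - int n - int k"] by (simp add: algebra_simps)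
    then show ?thesis by (simp add: F_def qfall_def)
  qed
  have f0: "qfact s N m \<noteq> 0" if "m < N" for m
    using qfact_nonzero[of m s N m] nz that by auto
  define t where "t = cg_poly s N n a b"
  define G where "G = cg_term s N n a b"
  \<comment> \<open>Matrix elements of the two sides of \<open>\<Delta>(X) P = P \<Delta>(X)\<close>, with \<open>P\<close> the projection onto the
    summand with parameter \<open>p\<^sub>3\<close>: the off-diagonal ones, \<open>L\<close> and \<open>R\<close>, agree after the shift of \<open>z1\<close>.\<close>
  define L where "L z1 = qeps s N (of_nat z1 * b - of_nat z2 * a + of_nat z1 - of_nat (Suc z2))
     * (qfact s N (z1 + z2 - n) * qfall s N a z1 * qfall s N b z2)
     / (qfact s N (Suc z2) * F (z1 + z2 + 1))
     * (qnum s N (of_nat z1) / qfact s N z1)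
     * qsum s N n (of_nat z1 - 1) (of_nat (Suc z2)) (a - of_nat z1 + 1) (b - of_nat (Suc z2)) * t z1 z2" for z1
  define R where "R z1 = qeps s N (of_nat z1 * b - of_nat z2 * a + of_nat z1 + b - of_nat z2)
     * (qfact s N (Suc z1 + z2 - n) * qfall s N a (Suc z1) * qfall s N b z2)
     / (qfact s N z1 * qfact s N (Suc z2) * F (z1 + z2 + 2))
     * t (Suc z1) z2 * t z1 (Suc z2)" for z1
  \<comment> \<open>The undivided factor \<open>[z1]\<close> closes the range on the left.\<close>
  have L0: "L 0 = 0" by (simp add: L_def)
  have LR: "L (Suc z1) = R z1" if "Suc z1 < N" for z1
  proof -
    have 1: "qnum s N (of_nat (Suc z1)) / qfact s N (Suc z1) = 1 / qfact s N z1"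
      using that nz[of "Suc z1"] by (intro qnum_times_div_qfact_Suc) auto
    have 2: "of_nat (Suc z1) * b - of_nat z2 * a + of_nat (Suc z1) - of_nat (Suc z2)
        = of_nat z1 * b - of_nat z2 * a + of_nat z1 + b - of_nat z2"
      by (simp add: algebra_simps)
    have 3: "qsum s N n (of_nat (Suc z1) - 1) (of_nat (Suc z2)) (a - of_nat (Suc z1) + 1) (b - of_nat (Suc z2)) = t z1 (Suc z2)"
      by (simp add: t_def cg_poly_def)
    show ?thesis unfolding L_def 1 2 3 R_def by (simp add: mult_ac)
  qed
  \<comment> \<open>The range closes on the right by \<open>[N] = 0\<close>: for
    \<open>z2 < n\<close> every summand of \<open>t N z2\<close> vanishes, otherwise
    \<open>[N + z2 - n]!\<close> does.\<close>
  have RN: "R z1 = 0" if "Suc z1 = N" for z1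
  proof (cases "z2 < n")
    case True
    have "t N z2 = 0"
      unfolding t_def cg_poly_def qsum_def
    proof (rule sum.neutral, rule ballI)
      fix \<nu> assume "\<nu> \<in> {..n}"
      show "(- 1) ^ \<nu> * qeps s N (- of_nat \<nu> * (of_nat N + of_nat z2 + (a - of_nat N) + (b - of_nat z2) - of_nat n + 1))
        * (qfall s N (a - of_nat N) (n - \<nu>) * qfall s N (b - of_nat z2) \<nu> * qfall s N (of_nat N) \<nu> * qfall s N (of_nat z2) (n - \<nu>))
        / (qfact s N \<nu> * qfact s N (n - \<nu>)) = 0"
      proof (cases \<nu>)
        case 0
        then show ?thesis using True by (simp add: qfall_of_nat_eq_0)
      next
        case (Suc k)
        then have "qfall s N (of_nat N) \<nu> = 0"
          using qnum_multiple[of s N 1] by (simp add: qfall_Suc_left)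
        then show ?thesis by simp
      qed
    qed
    then show ?thesis using that by (simp add: R_def)
  next
    case False
    then have "qfact s N (Suc z1 + z2 - n) = 0"
      using that by (intro qfact_eq_0) auto
    then show ?thesis by (simp add: R_def)
  qed
  \<comment> \<open>The left side is the first recurrence times \<open>P1 * t z1 z2\<close>, the
    right side the dual one times \<open>P2 * t z1 (Suc z2)\<close>.\<close>
  have step: "G z1 z2 + L z1 = G z1 (Suc z2) + R z1" if "z1 < N" for z1
  proof -
    define P1 where "P1 = qeps s N (of_nat z1 * b - of_nat z2 * a + of_nat z1)
       * (qfact s N (z1 + z2 - n) * qfall s N a z1 * qfall s N b z2)
       / (qfact s N z1 * qfact s N (Suc z2) * F (z1 + z2 + 1))"
    define P2 where "P2 = qeps s N (of_nat z1 * b - of_nat z2 * a + of_nat z1)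
       * (qfact s N (z1 + Suc z2 - n) * qfall s N a z1 * qfall s N b z2)
       / (qfact s N z1 * qfact s N (Suc z2) * F (z1 + z2 + 2))"
    have nz': "\<And>k. 0 < k \<Longrightarrow> k \<le> n \<Longrightarrow> qnum s N (of_nat k) \<noteq> 0"
      using nz assms(1) by auto
    have rec: "qeps s N (- of_nat (Suc z2)) * qnum s N (of_nat z1)
         * qsum s N n (of_nat z1 - 1) (of_nat (Suc z2)) (a - of_nat z1 + 1) (b - of_nat (Suc z2))
       + qeps s N (of_nat z1) * qnum s N (of_nat (Suc z2)) * t z1 z2
       = qnum s N (of_nat z1 + of_nat (Suc z2) - of_nat n) * t z1 (Suc z2)"
      using qsum_recurrence[OF nz', where x="of_nat z1" and y="of_nat (Suc z2)" and x'="a - of_nat z1" and y'="b - of_nat (Suc z2)"]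
      by (simp add: t_def cg_poly_def)
    have rec': "qeps s N (b - of_nat z2) * qnum s N (a - of_nat z1) * t (Suc z1) z2
       + qeps s N (- (a - of_nat z1)) * qnum s N (b - of_nat z2) * t z1 (Suc z2)
       = qnum s N (a - of_nat z1 + (b - of_nat z2) - of_nat n) * t z1 z2"
      using qsum_recurrence_dual[OF nz', where x="of_nat z1" and y="of_nat z2" and x'="a - of_nat z1" and y'="b - of_nat z2"]
      by (simp add: t_def cg_poly_def algebra_simps)
    have z2: "qnum s N (of_nat (Suc z2)) \<noteq> 0" "qfact s N (Suc z2) \<noteq> 0" "qfact s N z2 \<noteq> 0"
      using nz[of "Suc z2"] f0 assms(2) by auto
    have e1: "qeps s N (of_nat z1 * b - of_nat z2 * a + 2 * of_nat z1)
      = qeps s N (of_nat z1 * b - of_nat z2 * a + of_nat z1) * qeps s N (of_nat z1)"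
     and e2: "qeps s N (of_nat z1 * b - of_nat z2 * a + of_nat z1 - of_nat (Suc z2))
      = qeps s N (of_nat z1 * b - of_nat z2 * a + of_nat z1) * qeps s N (- of_nat (Suc z2))"
     and e3: "qeps s N (of_nat z1 * b - of_nat (Suc z2) * a + 2 * of_nat z1)
      = qeps s N (of_nat z1 * b - of_nat z2 * a + of_nat z1) * qeps s N (- (a - of_nat z1))"
     and e4: "qeps s N (of_nat z1 * b - of_nat z2 * a + of_nat z1 + b - of_nat z2)
      = qeps s N (of_nat z1 * b - of_nat z2 * a + of_nat z1) * qeps s N (b - of_nat z2)"
      unfolding qeps_add[symmetric] by (simp_all add: algebra_simps)
    have inv: "1 / qfact s N z2 = qnum s N (of_nat (Suc z2)) / qfact s N (Suc z2)"
      using qnum_times_div_qfact_Suc[OF z2(1)] by simp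
    have g1: "G z1 z2 = P1 * (qeps s N (of_nat z1) * qnum s N (of_nat (Suc z2)) * t z1 z2) * t z1 z2"
    proof -
      have "G z1 z2 = qeps s N (of_nat z1 * b - of_nat z2 * a + 2 * of_nat z1)
        * (qfact s N (z1 + z2 - n) * qfall s N a z1 * qfall s N b z2)
        / (qfact s N z1 * F (z1 + z2 + 1)) * (1 / qfact s N z2) * (t z1 z2)\<^sup>2"
        by (simp add: G_def cg_term_def F_def t_def)
      then show ?thesis unfolding e1 inv P1_def by (simp add: power2_eq_square mult_ac)
    qed
    have l: "L z1 = P1 * (qeps s N (- of_nat (Suc z2)) * qnum s N (of_nat z1)
         * qsum s N n (of_nat z1 - 1) (of_nat (Suc z2)) (a - of_nat z1 + 1) (b - of_nat (Suc z2))) * t z1 z2"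
      unfolding L_def e2 P1_def by (simp add: mult_ac)
    have g2: "G z1 (Suc z2) = P2 * (qeps s N (- (a - of_nat z1)) * qnum s N (b - of_nat z2) * t z1 (Suc z2)) * t z1 (Suc z2)"
    proof -
      have "G z1 (Suc z2) = qeps s N (of_nat z1 * b - of_nat (Suc z2) * a + 2 * of_nat z1)
        * (qfact s N (z1 + Suc z2 - n) * qfall s N a z1 * qfall s N b (Suc z2))
        / (qfact s N z1 * qfact s N (Suc z2) * F (z1 + z2 + 2)) * (t z1 (Suc z2))\<^sup>2"
        by (simp add: G_def cg_term_def F_def t_def)
      then show ?thesis unfolding e3 qfall_Suc P2_def by (simp add: power2_eq_square mult_ac)
    qed
    have r: "R z1 = P2 * (qeps s N (b - of_nat z2) * qnum s N (a - of_nat z1) * t (Suc z1) z2) * t z1 (Suc z2)"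
      unfolding R_def e4 qfall_Suc P2_def by (simp add: mult_ac)
    have "G z1 z2 + L z1 = P1 * (qnum s N (of_nat z1 + of_nat (Suc z2) - of_nat n) * t z1 (Suc z2)) * t z1 z2"
      unfolding g1 l rec[symmetric] by (simp add: algebra_simps)
    \<comment> \<open>From \<open>P1\<close> to \<open>P2\<close> the factorial and \<open>F\<close>
      each gain one factor, namely the two right-hand coefficients of the recurrences. If
      \<open>z1 + z2 < n\<close>, the subtraction in the factorial is truncated, but
      \<open>t z1 z2 = 0\<close>.\<close>
    also have "\<dots> = P2 * (qnum s N (a - of_nat z1 + (b - of_nat z2) - of_nat n) * t z1 z2) * t z1 (Suc z2)"
    proof (cases "z1 + z2 < n")
      case True
      then show ?thesis by (simp add: t_def cg_poly_eq_0)
    next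
      case False
      define c where "c = qnum s N (a - of_nat z1 + (b - of_nat z2) - of_nat n)"
      have "qfact s N (z1 + Suc z2 - n) = qfact s N (z1 + z2 - n) * qnum s N (of_nat z1 + of_nat (Suc z2) - of_nat n)"
        using False qfact_Suc[of s N "z1 + z2 - n"] by (simp add: Suc_diff_le of_nat_diff algebra_simps)
      moreover have "F (z1 + z2 + 2) = F (z1 + z2 + 1) * c"
        by (simp add: F_def qfall_Suc c_def algebra_simps)
      moreover have "F (z1 + z2 + 2) \<noteq> 0" by (rule F0)
      ultimately have "P1 * qnum s N (of_nat z1 + of_nat (Suc z2) - of_nat n) = P2 * c"
        by (simp add: P1_def P2_def mult_ac)
      then show ?thesis unfolding c_def[symmetric] by (simp add: algebra_simps)
    qed
    also have "\<dots> = G z1 (Suc z2) + R z1"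
      unfolding g2 r rec'[symmetric] by (simp add: algebra_simps)
    finally show ?thesis .
  qed
  obtain M where M: "N = Suc M" using assms(1) by (cases N) auto
  have "sum L {..<N} = (\<Sum>z1<M. L (Suc z1))"
    unfolding M by (subst sum.lessThan_Suc_shift) (simp add: L0)
  also have "\<dots> = sum R {..<N}"
    using RN[of M] by (simp add: M LR)
  finally have "sum L {..<N} = sum R {..<N}" .
  moreover have "(\<Sum>z1<N. G z1 z2 + L z1) = (\<Sum>z1<N. G z1 (Suc z2) + R z1)"
    by (rule sum.cong) (use step in auto)
  ultimately show ?thesis
    by (simp add: sum.distrib G_def)
qed

subsection \<open>Evaluation at index zero\<close>

text \<open>Beyond \<open>[n]!\<close> each factor is \<open>[N - (m - i)]\<close>, which reflection
  turns into a multiple of \<open>[m - i]\<close>. This supplies the \<open>q\<close>-binomial of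
  \<open>m\<close> that makes the sum a Vandermonde sum.\<close>

lemma qfact_root_of_unity:
  assumes N: "N = n + m + 1" and "j \<le> m"
  shows "qfact s N (n + j)
    = (- 1) ^ j * qeps s N (- of_nat j * of_nat N) * qfact s N n * qfall s N (of_nat m) j"
  using assms(2)
proof (induction j)
  case (Suc j)
  have "of_nat (Suc (n + j)) = (of_nat N - (of_nat m - of_nat j) :: complex)"
    by (simp add: N)
  then have "qnum s N (of_nat (Suc (n + j))) = - qeps s N (- of_nat N) * qnum s N (of_nat m - of_nat j)"
    by (simp only: qnum_reflect)
  moreover have "qeps s N (- of_nat (Suc j) * of_nat N) = qeps s N (- of_nat j * of_nat N) * qeps s N (- of_nat N)"
    by (simp add: algebra_simps flip: qeps_add)
  ultimately show ?case
    using Suc by (simp add: qfact_Suc qfall_Suc del: of_nat_Suc)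
qed simp

lemma sum_cg_term_0:
  assumes N: "N = n + m + 1"
    and nz: "\<And>k. 0 < k \<Longrightarrow> k < N \<Longrightarrow> qnum s N (of_nat k) \<noteq> 0"
    and F0: "qfall s N (a + b - of_nat n + 1) N \<noteq> 0"
  shows "(\<Sum>z1<N. cg_term s N n a b z1 0)
    = qeps s N (of_nat n * (b + 2) - 2 * of_nat n * (a + b - of_nat n + 1) - of_nat m * (a - of_nat n))
      * (qfall s N a n * qfall s N b n * qfall s N b (N - 1))
      / (qfact s N n * qfall s N (a + b - of_nat n + 1) N)"
proof -
  define F where "F = qfall s N (a + b - of_nat n + 1)"
  define \<alpha> where "\<alpha> = a - of_nat n"
  define \<beta> where "\<beta> = b - of_nat n"
  have F: "F (n + 1 + j) = F (n + 1) * qfall s N (\<alpha> + \<beta>) j" for j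
    unfolding F_def by (subst qfall_add) (simp add: \<alpha>_def \<beta>_def algebra_simps)
  have FN: "F N = F (n + 1) * qfall s N (\<alpha> + \<beta>) m"
    unfolding F[symmetric] by (simp add: N)
  have f0: "qfact s N k \<noteq> 0" if "k < N" for k
    using qfact_nonzero[of k s N k] nz that by auto
  \<comment> \<open>The factor \<open>[0; n - \<nu>]!\<close> leaves only
    \<open>\<nu> = n\<close>.\<close>
  have t: "cg_poly s N n a b z 0 = (- 1) ^ n * qeps s N (- of_nat n * (a + b - of_nat n + 1))
     * qfall s N b n * qfall s N (of_nat z) n / qfact s N n" for z
  proof -
    have "cg_poly s N n a b z 0 = (\<Sum>\<nu>\<le>n. if \<nu> = n then (- 1) ^ n * qeps s N (- of_nat n * (a + b - of_nat n + 1))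
     * qfall s N b n * qfall s N (of_nat z) n / qfact s N n else 0)"
      unfolding cg_poly_def qsum_def
      using qfall_of_nat_eq_0[of 0 _ s N]
      by (intro sum.cong refl) (auto simp: ac_simps)
    then show ?thesis by simp
  qed
  define K where "K = qeps s N (- 2 * of_nat n * (a + b - of_nat n + 1)) * (qfall s N b n)\<^sup>2 / (qfact s N n)\<^sup>2"
  have t2: "(cg_poly s N n a b z 0)\<^sup>2 = K * (qfall s N (of_nat z) n)\<^sup>2" for z
  proof -
    have "qeps s N (- 2 * of_nat n * (a + b - of_nat n + 1))
       = qeps s N (- of_nat n * (a + b - of_nat n + 1)) * qeps s N (- of_nat n * (a + b - of_nat n + 1))"
      unfolding qeps_add[symmetric] by (rule arg_cong[where f="qeps s N"]) simp
    then show ?thesis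
      by (simp add: t K_def power_mult_distrib power_divide power2_eq_square)
  qed
  have "(\<Sum>z1<N. cg_term s N n a b z1 0) = (\<Sum>z1=n..<N. cg_term s N n a b z1 0)"
    by (rule sum.mono_neutral_right) (auto simp: cg_term_eq_0 N)
  also have "\<dots> = (\<Sum>j\<le>m. cg_term s N n a b (n + j) 0)"
    by (rule sum.reindex_bij_witness[of _ "\<lambda>j. n + j" "\<lambda>j. j - n"]) (auto simp: N)
  also have "\<dots> = (\<Sum>j\<le>m. (qeps s N (of_nat n * (b + 2)) * K * qfall s N a n * qfact s N n / F (n + 1))
     * ((- 1) ^ j * qeps s N (of_nat j * (\<beta> - of_nat m + 1)) * qdiv s N (of_nat m) j * qfall s N \<alpha> j / qfall s N (\<alpha> + \<beta>) j))"
  proof (intro sum.cong refl)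
    fix j assume "j \<in> {..m}"
    then have j: "j \<le> m" by simp
    have fact: "qfact s N (n + j) = qfact s N j * qfall s N (of_nat (n + j)) n"
      using qfact_add[of s N j n] by (simp add: add.commute)
    then have nzj: "qfact s N j \<noteq> 0" "qfall s N (of_nat (n + j)) n \<noteq> 0"
      using f0[of "n + j"] j by (auto simp: N)
    have root: "qfact s N j * qfall s N (of_nat (n + j)) n
       = (- 1) ^ j * qeps s N (- of_nat j * of_nat N) * qfact s N n * qfall s N (of_nat m) j"
      using qfact_root_of_unity[OF N j, of s] unfolding fact .
    have e: "qeps s N (of_nat (n + j) * b - of_nat 0 * a + 2 * of_nat (n + j))
      * qeps s N (- of_nat j * of_nat N) = qeps s N (of_nat n * (b + 2)) * qeps s N (of_nat j * (\<beta> - of_nat m + 1))"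
      unfolding qeps_add[symmetric] by (rule arg_cong[where f="qeps s N"]) (simp add: N \<beta>_def algebra_simps)
    have "cg_term s N n a b (n + j) 0 = qeps s N (of_nat (n + j) * b - of_nat 0 * a + 2 * of_nat (n + j))
        * (qfact s N j * (qfall s N a n * qfall s N \<alpha> j))
        / (qfact s N j * qfall s N (of_nat (n + j)) n * (F (n + 1) * qfall s N (\<alpha> + \<beta>) j))
        * (K * (qfall s N (of_nat (n + j)) n)\<^sup>2)"
      unfolding cg_term_def t2 F_def[symmetric] F[symmetric] fact[symmetric]
      by (simp add: qfall_add \<alpha>_def)
    \<comment> \<open>Of the squared \<open>[n + j; n]!\<close>, one copy cancels the denominator;
      the other, with \<open>[j]!\<close>, forms \<open>[n + j]!\<close>, ready for
      reflection.\<close>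
    also have "\<dots> = qeps s N (of_nat (n + j) * b - of_nat 0 * a + 2 * of_nat (n + j))
        * (qfact s N j * qfall s N (of_nat (n + j)) n)
        * (K * qfall s N a n / F (n + 1)) * (qfall s N \<alpha> j / (qfact s N j * qfall s N (\<alpha> + \<beta>) j))"
      using nzj by (simp add: power2_eq_square)
    also have "\<dots> = (qeps s N (of_nat (n + j) * b - of_nat 0 * a + 2 * of_nat (n + j))
        * qeps s N (- of_nat j * of_nat N)) * ((- 1) ^ j * qfact s N n * qfall s N (of_nat m) j)
        * (K * qfall s N a n / F (n + 1)) * (qfall s N \<alpha> j / (qfact s N j * qfall s N (\<alpha> + \<beta>) j))"
      unfolding root by (simp only: ac_simps)
    finally show "cg_term s N n a b (n + j) 0 = (qeps s N (of_nat n * (b + 2)) * K * qfall s N a n * qfact s N n / F (n + 1))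
     * ((- 1) ^ j * qeps s N (of_nat j * (\<beta> - of_nat m + 1)) * qdiv s N (of_nat m) j * qfall s N \<alpha> j / qfall s N (\<alpha> + \<beta>) j)"
      unfolding e by (simp add: qdiv_def)
  qed
  also have "\<dots> = (qeps s N (of_nat n * (b + 2)) * K * qfall s N a n * qfact s N n / F (n + 1))
     * (qeps s N (- of_nat m * \<alpha>) * qfall s N \<beta> m / qfall s N (\<alpha> + \<beta>) m)"
  proof -
    have "qfall s N (\<alpha> + \<beta>) m \<noteq> 0"
      using F0 FN by (auto simp flip: F_def)
    moreover have "qnum s N (of_nat k) \<noteq> 0" if "0 < k" "k \<le> m" for k
      using nz that by (simp add: N)
    ultimately show ?thesis
      unfolding sum_distrib_left[symmetric] by (subst q_vandermonde) auto
  qed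
  also have "\<dots> = (qeps s N (of_nat n * (b + 2)) * qeps s N (- 2 * of_nat n * (a + b - of_nat n + 1)) * qeps s N (- of_nat m * \<alpha>))
      * (qfall s N a n * qfall s N b n * (qfall s N b n * qfall s N \<beta> m)) / (qfact s N n * F N)"
    unfolding FN K_def using f0[of n] N by (simp add: power2_eq_square mult_ac)
  \<comment> \<open>As \<open>n + m = N - 1\<close>, two products depending on \<open>n\<close>
    merge into the one in the final ratio.\<close>
  also have "qfall s N b n * qfall s N \<beta> m = qfall s N b (N - 1)"
    by (simp add: N \<beta>_def qfall_add)
  also have "qeps s N (of_nat n * (b + 2)) * qeps s N (- 2 * of_nat n * (a + b - of_nat n + 1)) * qeps s N (- of_nat m * \<alpha>)
     = qeps s N (of_nat n * (b + 2) - 2 * of_nat n * (a + b - of_nat n + 1) - of_nat m * (a - of_nat n))"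
    unfolding qeps_add[symmetric] \<alpha>_def by (rule arg_cong[where f="qeps s N"]) (simp add: algebra_simps)
  finally show ?thesis by (simp add: F_def)
qed

subsection \<open>Squared Clebsch-Gordan coefficients\<close>

definition cg_norm :: "int \<Rightarrow> nat \<Rightarrow> nat \<Rightarrow> complex \<Rightarrow> complex \<Rightarrow> complex" where
  "cg_norm s N n a b = qnum s N (a + b - 2 * of_nat n + 1) * qfact s N n
     * qeps s N (of_nat n - (of_nat n)\<^sup>2 + of_nat n * (a + b)) / (qfall s N a n * qfall s N b n)"

text \<open>Additivity of the factorwise roots makes every root depending on \<nu> occur twice, so
  the summands become rational up to a common factor \<open>C\<close>, which is then
  squared.\<close>

lemma clebsch_gordan_power2:
  assumes "n \<le> z1 + z2"
    and a: "qfall s N (2 * p1) n \<noteq> 0" and b: "qfall s N (2 * p2) n \<noteq> 0"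
    and f1: "qfact s N z1 \<noteq> 0" and f2: "qfact s N z2 \<noteq> 0"
  shows "(clebsch_gordan s N p1 p2 n z1 z2 (z1 + z2 - n))\<^sup>2
    = cg_norm s N n (2 * p1) (2 * p2) * (qeps s N (- 2 * of_nat z1) * cg_term s N n (2 * p1) (2 * p2) z1 z2)"
proof -
  define r where "r = qfall_sqrt s N"
  define rF where "rF = r (2 * p1 + 2 * p2 - of_nat n + 1) (z1 + z2 + 1)"
  define x where "x = (of_nat n - (of_nat n)\<^sup>2) / 2 + (of_nat n - of_nat z2) * p1 + (of_nat n + of_nat z1) * p2"
  define C where "C = qeps s N x * (r (2 * p1) z1 * r (2 * p2) z2) / (r (2 * p1) n * r (2 * p2) n * rF * qfact s N z1 * qfact s N z2)"
  define T where "T \<nu> = (- 1) ^ \<nu> * qeps s N (- of_nat \<nu> * (2 * p1 + 2 * p2 - of_nat n + 1))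
     * (qfall s N (2 * p1 - of_nat z1) (n - \<nu>) * qfall s N (2 * p2 - of_nat z2) \<nu> * qfall s N (of_nat z1) \<nu> * qfall s N (of_nat z2) (n - \<nu>))
     / (qfact s N \<nu> * qfact s N (n - \<nu>))" for \<nu>
  have poly: "cg_poly s N n (2 * p1) (2 * p2) z1 z2 = (\<Sum>\<nu>\<le>n. T \<nu>)"
    unfolding cg_poly_def qsum_def T_def by (intro sum.cong refl) simp
  also have "\<dots> = (\<Sum>\<nu>=n - z2..min n z1. T \<nu>)"
    by (rule sum.mono_neutral_right) (auto simp: T_def qfall_of_nat_eq_0 not_le)
  finally have poly: "cg_poly s N n (2 * p1) (2 * p2) z1 z2 = (\<Sum>\<nu>=n - z2..min n z1. T \<nu>)" .
  have "(\<Sum>\<nu> = n - z2..min n z1.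
          (- 1) ^ \<nu> * qeps s N (- of_nat \<nu> * (p1 + p2 + (p1 + p2 - of_nat n) + 1)) * qeps s N x
          / (qfact s N \<nu> * qfact s N (n - \<nu>) * qfact s N (z1 - \<nu>) * qfact s N (z2 + \<nu> - n))
          * (r (2 * p1 - of_nat n) (z1 - \<nu>) * r (2 * p1 - of_nat z1) (n - \<nu>)
             * r (2 * p2 - of_nat n) (z2 + \<nu> - n) * r (2 * p2 - of_nat z2) \<nu> / rF))
     = C * (\<Sum>\<nu>=n - z2..min n z1. T \<nu>)"
    unfolding sum_distrib_left
  proof (intro sum.cong refl)
    fix \<nu> assume "\<nu> \<in> {n - z2..min n z1}"
    then have \<nu>: "\<nu> \<le> n" "\<nu> \<le> z1" "n \<le> z2 + \<nu>" by auto
    have r0: "r (2 * p1) n \<noteq> 0" "r (2 * p2) n \<noteq> 0" using a b by (simp_all add: r_def)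
    \<comment> \<open>Both sides are the root product of length \<open>n + z1 - \<nu>\<close>
      starting at \<open>2 * p1\<close>.\<close>
    have "r (2 * p1) n * r (2 * p1 - of_nat n) (z1 - \<nu>) = r (2 * p1) z1 * r (2 * p1 - of_nat z1) (n - \<nu>)"
      unfolding r_def qfall_sqrt_add[symmetric] using \<nu> by (simp add: add.commute)
    then have r1: "r (2 * p1 - of_nat n) (z1 - \<nu>) = r (2 * p1) z1 * r (2 * p1 - of_nat z1) (n - \<nu>) / r (2 * p1) n"
      using r0 by (simp add: field_simps)
    have "r (2 * p2) n * r (2 * p2 - of_nat n) (z2 + \<nu> - n) = r (2 * p2) z2 * r (2 * p2 - of_nat z2) \<nu>"
      unfolding r_def qfall_sqrt_add[symmetric] using \<nu> by simp
    then have r2: "r (2 * p2 - of_nat n) (z2 + \<nu> - n) = r (2 * p2) z2 * r (2 * p2 - of_nat z2) \<nu> / r (2 * p2) n"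
      using r0 by (simp add: field_simps)
    have fz1: "qfact s N z1 = qfact s N (z1 - \<nu>) * qfall s N (of_nat z1) \<nu>"
      using qfact_add[of s N "z1 - \<nu>" \<nu>] \<nu> by simp
    have "z2 + \<nu> - n + (n - \<nu>) = z2" using \<nu> by simp
    then have fz2: "qfact s N z2 = qfact s N (z2 + \<nu> - n) * qfall s N (of_nat z2) (n - \<nu>)"
      using qfact_add[of s N "z2 + \<nu> - n" "n - \<nu>"] by simp
    have i1: "1 / qfact s N (z1 - \<nu>) = qfall s N (of_nat z1) \<nu> / qfact s N z1"
      and i2: "1 / qfact s N (z2 + \<nu> - n) = qfall s N (of_nat z2) (n - \<nu>) / qfact s N z2"
      using f1 f2 unfolding fz1 fz2 by (simp_all add: field_simps)
    have s1: "r (2 * p1 - of_nat z1) (n - \<nu>) * r (2 * p1 - of_nat z1) (n - \<nu>) = qfall s N (2 * p1 - of_nat z1) (n - \<nu>)"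
      and s2: "r (2 * p2 - of_nat z2) \<nu> * r (2 * p2 - of_nat z2) \<nu> = qfall s N (2 * p2 - of_nat z2) \<nu>"
      unfolding r_def by (simp_all flip: power2_eq_square)
    define E where "E = (- 1) ^ \<nu> * qeps s N (- of_nat \<nu> * (2 * p1 + 2 * p2 - of_nat n + 1))"
    have E: "(- 1) ^ \<nu> * qeps s N (- of_nat \<nu> * (p1 + p2 + (p1 + p2 - of_nat n) + 1)) = E"
      by (simp add: E_def algebra_simps)
    have "E * qeps s N x
          / (qfact s N \<nu> * qfact s N (n - \<nu>) * qfact s N (z1 - \<nu>) * qfact s N (z2 + \<nu> - n))
          * (r (2 * p1 - of_nat n) (z1 - \<nu>) * r (2 * p1 - of_nat z1) (n - \<nu>)
             * r (2 * p2 - of_nat n) (z2 + \<nu> - n) * r (2 * p2 - of_nat z2) \<nu> / rF)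
       = E * qeps s N x / (qfact s N \<nu> * qfact s N (n - \<nu>)) * (1 / qfact s N (z1 - \<nu>)) * (1 / qfact s N (z2 + \<nu> - n))
          * (r (2 * p1) z1 * r (2 * p2) z2 * (r (2 * p1 - of_nat z1) (n - \<nu>) * r (2 * p1 - of_nat z1) (n - \<nu>))
            * (r (2 * p2 - of_nat z2) \<nu> * r (2 * p2 - of_nat z2) \<nu>) / (r (2 * p1) n * r (2 * p2) n * rF))"
      unfolding r1 r2 by simp
    also have "\<dots> = C * T \<nu>"
      unfolding s1 s2 i1 i2 C_def T_def E_def[symmetric] by (simp add: mult_ac)
    finally show "(- 1) ^ \<nu> * qeps s N (- of_nat \<nu> * (p1 + p2 + (p1 + p2 - of_nat n) + 1)) * qeps s N x
          / (qfact s N \<nu> * qfact s N (n - \<nu>) * qfact s N (z1 - \<nu>) * qfact s N (z2 + \<nu> - n))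
          * (r (2 * p1 - of_nat n) (z1 - \<nu>) * r (2 * p1 - of_nat z1) (n - \<nu>)
             * r (2 * p2 - of_nat n) (z2 + \<nu> - n) * r (2 * p2 - of_nat z2) \<nu> / rF) = C * T \<nu>"
      unfolding E .
  qed
  then have "clebsch_gordan s N p1 p2 n z1 z2 (z1 + z2 - n)
     = csqrt (qnum s N (2 * p1 + 2 * p2 - 2 * of_nat n + 1))
     * csqrt (qfact s N n * qfact s N z1 * qfact s N z2 * qfact s N (z1 + z2 - n))
     * (C * cg_poly s N n (2 * p1) (2 * p2) z1 z2)"
    using assms(1) unfolding clebsch_gordan_def Let_def x_def[symmetric] r_def[symmetric] rF_def[symmetric] poly
    by simp
  then have cg: "(clebsch_gordan s N p1 p2 n z1 z2 (z1 + z2 - n))\<^sup>2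
     = qnum s N (2 * p1 + 2 * p2 - 2 * of_nat n + 1)
     * (qfact s N n * qfact s N z1 * qfact s N z2 * qfact s N (z1 + z2 - n))
     * (C\<^sup>2 * (cg_poly s N n (2 * p1) (2 * p2) z1 z2)\<^sup>2)"
    by (simp add: power_mult_distrib)
  have C2: "C\<^sup>2 = (qeps s N x)\<^sup>2 * (qfall s N (2 * p1) z1 * qfall s N (2 * p2) z2)
     / (qfall s N (2 * p1) n * qfall s N (2 * p2) n * qfall s N (2 * p1 + 2 * p2 - of_nat n + 1) (z1 + z2 + 1)
        * (qfact s N z1)\<^sup>2 * (qfact s N z2)\<^sup>2)"
    by (simp add: C_def power_mult_distrib power_divide r_def rF_def)
  have x2: "(qeps s N x)\<^sup>2 = qeps s N (of_nat n - (of_nat n)\<^sup>2 + of_nat n * (2 * p1 + 2 * p2))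
     * (qeps s N (- 2 * of_nat z1) * qeps s N (of_nat z1 * (2 * p2) - of_nat z2 * (2 * p1) + 2 * of_nat z1))"
    unfolding power2_eq_square[of "qeps s N x"] qeps_add[symmetric]
    by (rule arg_cong[where f="qeps s N"]) (simp add: x_def algebra_simps)
  show ?thesis
    unfolding cg C2 x2 cg_norm_def cg_term_def using f1 f2 by (simp add: power2_eq_square mult_ac)
qed

text \<open>Vanishing of \<open>[x]\<close> depends on \<open>x\<close> only modulo
  \<open>N\<close>, and the longest denominator in \<open>cg_defined\<close> runs through all
  residue classes.\<close>

lemma qnum_generic:
  assumes "n < N" "cg_defined s N p1 p2 n"
  shows "qnum s N (2 * p1 + 2 * p2 + of_int j) \<noteq> 0"
proof -
  define k where "k = (1 - int n - j) mod int N"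
  define l where "l = (1 - int n - j) div int N"
  have k: "0 \<le> k" "k < int N" using assms(1) by (auto simp: k_def)
  \<comment> \<open>The choice \<open>z1 = N - 1\<close>, \<open>z2 = n\<close> gives the admissible
    \<open>z3 = N - 1\<close> and \<open>N + n\<close> consecutive factors.\<close>
  have "qfall s N (2 * p1 + 2 * p2 - of_nat n + 1) (N - 1 + n + 1) \<noteq> 0"
    using assms unfolding cg_defined_def by (elim allE[of _ "N - 1"] allE[of _ n]) auto
  then have "\<forall>i<N + n. qnum s N (2 * p1 + 2 * p2 - of_nat n + 1 - of_nat i) \<noteq> 0"
    using assms(1) by (simp add: qfall_def)
  moreover have "nat k < N + n" using k by linarith
  ultimately have "qnum s N (2 * p1 + 2 * p2 - of_nat n + 1 - of_nat (nat k)) \<noteq> 0"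
    by blast
  moreover have "2 * p1 + 2 * p2 - of_nat n + 1 - of_nat (nat k) = 2 * p1 + 2 * p2 + of_int j + of_nat N * of_int l"
  proof -
    have "1 - int n - j = int N * l + k" by (simp add: k_def l_def)
    then have "of_int (1 - int n - j) = (of_int (int N * l + k) :: complex)" by simp
    moreover have "of_nat (nat k) = (of_int k :: complex)" using k by (simp add: of_nat_nat)
    ultimately show ?thesis by (simp add: algebra_simps)
  qed
  ultimately show ?thesis
    by (simp add: qnum_shift_multiple_eq_0_iff)
qed

lemma sum_cg_term:
  assumes "n < N" "z2 < N"
    and nz: "\<And>k. 0 < k \<Longrightarrow> k < N \<Longrightarrow> qnum s N (of_nat k) \<noteq> 0"
    and generic: "\<And>j :: int. qnum s N (a + b + of_int j) \<noteq> 0"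
  shows "(\<Sum>z1<N. cg_term s N n a b z1 z2)
    = qeps s N (of_nat n * (b + 2) - 2 * of_nat n * (a + b - of_nat n + 1) - of_nat (N - 1 - n) * (a - of_nat n))
      * (qfall s N a n * qfall s N b n * qfall s N b (N - 1))
      / (qfact s N n * qfall s N (a + b - of_nat n + 1) N)"
  using assms(2)
proof (induction z2)
  case 0
  have "qnum s N (a + b - of_nat n + 1 - of_nat k) \<noteq> 0" for k
    using generic[of "1 - int n - int k"] by (simp add: algebra_simps)
  then show ?case
    using assms(1) nz by (intro sum_cg_term_0) (auto simp: qfall_def)
next
  case (Suc z2)
  then show ?case
    using sum_cg_term_Suc[OF assms(1) Suc.prems nz generic] by simp
qed

section \<open>Evaluation of \<open>A\<close> and \<open>B\<close> and their ratio\<close>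

context
  fixes s :: int and N n :: nat and p1 p2 :: complex
  assumes coprime: "coprime s (int N)" and n: "n < N" and def: "cg_defined s N p1 p2 n"
    and p1: "qfall s N (2 * p1) (N - 1) \<noteq> 0" and p2: "qfall s N (2 * p2) (N - 1) \<noteq> 0"
begin

lemma clebsch_gordan_power2':
  assumes "n \<le> z1 + z2" "z1 < N" "z2 < N"
  shows "(clebsch_gordan s N p1 p2 n z1 z2 (z1 + z2 - n))\<^sup>2
    = cg_norm s N n (2 * p1) (2 * p2) * (qeps s N (- 2 * of_nat z1) * cg_term s N n (2 * p1) (2 * p2) z1 z2)"
proof (rule clebsch_gordan_power2)
  show "qfact s N z1 \<noteq> 0" "qfact s N z2 \<noteq> 0"
    using assms qnum_of_nat_nonzero[OF coprime] qfact_nonzero[of z1 s N z1] qfact_nonzero[of z2 s N z2] by auto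
  show "qfall s N (2 * p1) n \<noteq> 0" "qfall s N (2 * p2) n \<noteq> 0"
    using qfall_nonzero_mono[OF p1] qfall_nonzero_mono[OF p2] n by auto
qed fact

lemma cg_A_eq:
  assumes "z2 < N"
  shows "cg_A s N (rho N) p1 p2 n z2 = cg_norm s N n (2 * p1) (2 * p2) * qeps s N (of_nat (N - 1) * (2 * p1))
    * (\<Sum>z1<N. cg_term s N n (2 * p1) (2 * p2) z1 z2)"
proof -
  have "cg_A s N (rho N) p1 p2 n z2 = (\<Sum>z1 | z1 < N \<and> n \<le> z1 + z2 \<and> z1 + z2 - n < N.
     cg_norm s N n (2 * p1) (2 * p2) * qeps s N (of_nat (N - 1) * (2 * p1)) * cg_term s N n (2 * p1) (2 * p2) z1 z2)"
    unfolding cg_A_def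
  proof (intro sum.cong refl, clarify)
    fix z1 assume z1: "z1 < N" "n \<le> z1 + z2"
    \<comment> \<open>The weight \<open>rho\<close> is \<open>z1 + (N - 1) * p1\<close>, so its
      dependence on \<open>z1\<close> cancels.\<close>
    have e: "qeps s N (- 2 * of_nat z1) * qeps s N (2 * rho N p1 z1) = qeps s N (of_nat (N - 1) * (2 * p1))"
      unfolding qeps_add[symmetric] using n
      by (intro arg_cong[where f="qeps s N"]) (simp add: rho_def of_nat_diff algebra_simps)
    show "(clebsch_gordan s N p1 p2 n z1 z2 (z1 + z2 - n))\<^sup>2 * qeps s N (2 * rho N p1 z1)
      = cg_norm s N n (2 * p1) (2 * p2) * qeps s N (of_nat (N - 1) * (2 * p1)) * cg_term s N n (2 * p1) (2 * p2) z1 z2"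
      unfolding clebsch_gordan_power2'[OF z1(2,1) assms] e[symmetric] by (simp only: mult_ac)
  qed
  also have "\<dots> = (\<Sum>z1<N. cg_norm s N n (2 * p1) (2 * p2) * qeps s N (of_nat (N - 1) * (2 * p1)) * cg_term s N n (2 * p1) (2 * p2) z1 z2)"
    using n by (intro sum.mono_neutral_left) (auto dest: cg_term_nonzeroD)
  finally show ?thesis by (simp only: sum_distrib_left)
qed

lemma cg_B_eq:
  assumes "z1 < N"
  shows "cg_B s N (rho N) p1 p2 n z1 = cg_norm s N n (2 * p1) (2 * p2)
    * qeps s N (- of_nat (N - 1) * (2 * p2) - 2 * of_nat n * (2 * p1 + 2 * p2 - of_nat n + 1))
    * (\<Sum>z2<N. cg_term (- s) N n (2 * p2) (2 * p1) z2 z1)"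
    (is "_ = ?K * qeps s N ?x * _")
proof -
  have "cg_B s N (rho N) p1 p2 n z1 = (\<Sum>z2 | z2 < N \<and> n \<le> z1 + z2 \<and> z1 + z2 - n < N.
     ?K * qeps s N ?x * cg_term (- s) N n (2 * p2) (2 * p1) z2 z1)"
    unfolding cg_B_def
  proof (intro sum.cong refl, clarify)
    fix z2 assume z2: "z2 < N" "n \<le> z1 + z2"
    have e: "qeps s N (- 2 * of_nat n * (2 * p1 + 2 * p2 - of_nat n + 1)) * (qeps s N (2 * of_nat z2) * qeps s N (- 2 * rho N p2 z2))
       = qeps s N ?x"
      unfolding qeps_add[symmetric] using n
      by (intro arg_cong[where f="qeps s N"]) (simp add: rho_def of_nat_diff algebra_simps)
    show "(clebsch_gordan s N p1 p2 n z1 z2 (z1 + z2 - n))\<^sup>2 * qeps s N (- 2 * rho N p2 z2)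
      = ?K * qeps s N ?x * cg_term (- s) N n (2 * p2) (2 * p1) z2 z1"
      unfolding clebsch_gordan_power2'[OF z2(2) assms z2(1)] cg_term_swap e[symmetric] by (simp only: mult_ac)
  qed
  also have "\<dots> = (\<Sum>z2<N. ?K * qeps s N ?x * cg_term (- s) N n (2 * p2) (2 * p1) z2 z1)"
    using n by (intro sum.mono_neutral_left) (auto dest: cg_term_nonzeroD simp: add.commute)
  finally show ?thesis by (simp only: sum_distrib_left)
qed

lemma cg_A_div_cg_B:
  assumes "z1 < N" "z2 < N"
  shows "cg_A s N (rho N) p1 p2 n z2 / cg_B s N (rho N) p1 p2 n z1
     = qfall s N (2 * p2) (N - 1) / qfall s N (2 * p1) (N - 1)"
proof -
  define a where "a = 2 * p1"
  define b where "b = 2 * p2"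
  define \<kappa> where "\<kappa> = a + b - of_nat n + 1"
  define m where "m = N - 1 - n"
  \<comment> \<open>\<open>D\<close> collects what \<open>A\<close> and \<open>B\<close> share; it
    is symmetric in the two factors and unchanged under inversion of epsilon.\<close>
  define D where "D = cg_norm s N n a b * (qfall s N a n * qfall s N b n) / (qfact s N n * qfall s N \<kappa> N)"
  define u where "u = of_nat (N - 1) * a + (of_nat n * (b + 2) - 2 * of_nat n * \<kappa> - of_nat m * (a - of_nat n))"
  define v where "v = - of_nat (N - 1) * b - 2 * of_nat n * \<kappa> - (of_nat n * (a + 2) - 2 * of_nat n * \<kappa> - of_nat m * (b - of_nat n))"
  have nz: "qnum s N (of_nat k) \<noteq> 0" if "0 < k" "k < N" for k
    using qnum_of_nat_nonzero[OF coprime that] .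
  have generic: "qnum s N (a + b + of_int j) \<noteq> 0" for j :: int
    using qnum_generic[OF n def] by (simp add: a_def b_def)
  have A: "cg_A s N (rho N) p1 p2 n z2 = D * qeps s N u * qfall s N b (N - 1)"
    unfolding cg_A_eq[OF assms(2)] a_def[symmetric] b_def[symmetric]
    by (subst sum_cg_term[OF n assms(2) nz generic])
       (simp_all add: D_def u_def qeps_add \<kappa>_def m_def)
  have B: "cg_B s N (rho N) p1 p2 n z1 = D * qeps s N v * qfall s N a (N - 1)"
  proof -
    have "(\<Sum>z2<N. cg_term (- s) N n b a z2 z1) = qeps s N (- (of_nat n * (a + 2) - 2 * of_nat n * \<kappa> - of_nat m * (b - of_nat n)))
      * (qfall s N b n * qfall s N a n * qfall s N a (N - 1)) / (qfact s N n * qfall s N \<kappa> N)"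
      using sum_cg_term[OF n assms(1), of "- s" b a] nz generic
      by (simp add: qeps_uminus_s add.commute[of b a] \<kappa>_def m_def)
    moreover have "qeps s N v = qeps s N (- of_nat (N - 1) * b - 2 * of_nat n * \<kappa>)
        * qeps s N (- (of_nat n * (a + 2) - 2 * of_nat n * \<kappa> - of_nat m * (b - of_nat n)))"
      unfolding v_def qeps_add[symmetric] by simp
    ultimately show ?thesis
      unfolding cg_B_eq[OF assms(1)] a_def[symmetric] b_def[symmetric] \<kappa>_def[symmetric]
      by (simp add: D_def)
  qed
  have D0: "D \<noteq> 0"
  proof -
    have "qnum s N (a + b - 2 * of_nat n + 1) \<noteq> 0"
      using generic[of "1 - 2 * int n"] by (simp add: algebra_simps)
    moreover have "qfall s N \<kappa> N \<noteq> 0"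
    proof -
      have "qnum s N (\<kappa> - of_nat k) \<noteq> 0" for k
        using generic[of "1 - int n - int k"] by (simp add: \<kappa>_def algebra_simps)
      then show ?thesis by (simp add: qfall_def)
    qed
    moreover have "qfact s N n \<noteq> 0"
      using nz n qfact_nonzero[of n s N n] by auto
    moreover have "qfall s N a n \<noteq> 0" "qfall s N b n \<noteq> 0"
      using qfall_nonzero_mono[OF p1] qfall_nonzero_mono[OF p2] n unfolding a_def b_def by auto
    ultimately show ?thesis
      by (simp add: D_def cg_norm_def)
  qed
  \<comment> \<open>The exponents of \<open>A\<close> and \<open>B\<close> differ by a multiple of
    the period \<open>2 * N\<close>, which removes the last dependence on \<open>n\<close>.\<close>
  have "u = v + 2 * of_nat N * of_int (int n)"
  proof -
    have N: "of_nat m = (of_nat N - 1 - of_nat n :: complex)" "of_nat (N - 1) = (of_nat N - 1 :: complex)"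
      using n by (simp_all add: m_def of_nat_diff)
    then show ?thesis
      unfolding u_def v_def \<kappa>_def N by (simp add: algebra_simps)
  qed
  then have "qeps s N u = qeps s N v"
    using qeps_period[of N s "int n"] n by (simp add: qeps_add)
  then show ?thesis
    unfolding A B using D0 by (simp add: a_def b_def)
qed

end

theorem proposition3p1:
  fixes N :: nat and s :: int
  assumes "N \<ge> 2" and "coprime s (int N)"
  shows "\<exists>f :: complex \<Rightarrow> complex. \<forall>p1 p2.
    qfall s N (2 * p1) (N - 1) \<noteq> 0 \<and> qfall s N (2 * p2) (N - 1) \<noteq> 0 \<longrightarrow>
      qfall s N (2 * p2) (N - 1) / qfall s N (2 * p1) (N - 1) = f p1 / f p2 \<and>
      (\<forall>n<N. cg_defined s N p1 p2 n \<longrightarrow>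
        (\<forall>z1<N. \<forall>z2<N.
          cg_A s N (rho N) p1 p2 n z2 / cg_B s N (rho N) p1 p2 n z1
          = qfall s N (2 * p2) (N - 1) / qfall s N (2 * p1) (N - 1)))"
  using cg_A_div_cg_B[OF assms(2)]
  \<comment> \<open>Taking reciprocals puts the falling factorial of \<open>p2\<close> into the
    numerator.\<close>
  by (intro exI[of _ "\<lambda>p. 1 / qfall s N (2 * p) (N - 1)"]) auto

end
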